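(* Let $\mathfrak{X}$ be a nonempty compact convex subset of a Hausdorff locally convex topological vector space $V$ over $\mathbb{R}$, and let $\rho$ be a metric on $\mathfrak{X}$ compatible with the topology. Then $(\mathfrak{X},\rho)$ is affinely isometric to $(S(A),\rho_L)$ for some compact quantum metric space $(A,L)$ if and only if the metric $\rho$ is convex and midpoint-balanced. In this event, the closed compact quantum metric space is $(\mathrm{Af}_{\mathbb{R}}(\mathfrak{X})_L,L_\rho)$, unique up to isometry, where $\mathrm{Af}_{\mathbb{R}}(\mathfrak{X})_L$ is the space of Lipschitz functions (with respect to $\rho$) in $\mathrm{Af}_{\mathbb{R}}(\mathfrak{X})$ and $L_\rho(f)=\sup\{|f(x)-f(y)|/\rho(x,y):x\neq y\}$ is the Lipschitz seminorm.
   Context: An order-unit space is a real partially ordered vector space $A$ with a distinguished element $e=e_A$ (the order unit) such that (i) for each $a\in A$ there is $r\in\mathbb{R}$ with $a\le re$; (ii) if $a\le re$ for all real $r>0$ then $a\le 0$. Its norm is $\|a\|=\inf\{r\in\mathbb{R}:-re\le a\le re\}$. A state is a $\mu$ in the dual $A'$ with $\mu(e)=\|\mu\|'=1$; $S(A)$ is the (nonempty) set of states with the weak-$*$ topology. For a seminorm $L$ on $A$ put $\rho_L(\mu,\nu)=\sup\{|\mu(a)-\nu(a)|:a\in A,\ L(a)\le1\}$. $L$ is a Lip-norm, and $(A,L)$ is a compact quantum metric space, if (1) $L(a)=0$ if and only if $a\in\mathbb{R}e$; (2) the topology on $S(A)$ induced by $\rho_L$ is the weak-$*$ topology. Let $\bar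 A$ be the norm completion of $A$, $\bar L(b)=\inf\{\liminf_n L(a_n):a_n\in A,\ a_n\to b\}$ for $b\in\bar A$, $A^c=\{b\in\bar A:\bar L(b)<\infty\}$ and $L^c=\bar L|_{A^c}$. $(A,L)$ is closed if $L=L^c$. An isometry from $(A,L_A)$ to $(B,L_B)$ is an order isomorphism $\varphi$ (preserving order units) of $A^c$ onto $B^c$ with $L_A^c=L_B^c\circ\varphi$. $\mathrm{Af}_{\mathbb{R}}(\mathfrak{X})$ is the space of continuous affine real-valued functions on $\mathfrak{X}$, an order-unit space with pointwise order and order unit the constant function $1$. A metric $\rho$ on $\mathfrak{X}$ is midpoint-balanced if $\rho(\mu,\nu)=\rho(\mu',\nu')$ whenever $\mu,\nu,\mu',\nu'\in\mathfrak{X}$ satisfy $\frac{\mu+\nu'}{2}=\frac{\mu'+\nu}{2}$. It is convex if $\rho(t\mu+(1-t)\mu',t\nu+(1-t)\nu')\le t\rho(\mu,\nu)+(1-t)\rho(\mu',\nu')$ for all $\mu,\nu,\mu',\nu'\in\mathfrak{X}$ and $0\le t\le1$. *)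

theory Defs
  imports "HOL-Analysis.Analysis" "HOL-Library.Function_Algebras"
begin

section \<open>Hausdorff locally convex topological vector spaces over the reals\<close>

text \<open>
  Joint continuity of the scalar multiplication and a base of convex neighbourhoods of \<open>0\<close>, with
  \<open>convex\<close> and \<open>interior\<close> unfolded because they cannot be used inside the class specification.
\<close>

class locally_convex_t2_space = real_vector + topological_ab_group_add + t2_space +
  assumes tendsto_scaleR_Pair:
      "LIM p (nhds r \<times>\<^sub>F nhds a). fst p *\<^sub>R snd p :> nhds (r *\<^sub>R a)"
    and locally_convex_0:
      "open U \<Longrightarrow> 0 \<in> U \<Longrightarrow>
       \<exists>C W. open W \<and> 0 \<in> W \<and> W \<subseteq> C \<and> C \<subseteq> U \<and>
         (\<forall>x\<in>C. \<forall>y\<in>C. \<forall>u\<ge>0. \<forall>v\<ge>0. u + v = 1 \<longrightarrow> u *\<^sub>R x + v *\<^sub>R y \<in> C)"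

text \<open>
  Real-valued functions under pointwise operations.  \<open>Function_Algebras\<close> provides the additive
  structure; the scalar multiplication is added here, so that spaces of functions can be subspaces.
\<close>

instantiation "fun" :: (type, real_vector) real_vector
begin

definition "scaleR r f = (\<lambda>x. r *\<^sub>R f x)"

instance
  by standard (simp_all add: scaleR_fun_def fun_eq_iff scaleR_add_right scaleR_add_left)

end


section \<open>Order-unit spaces\<close>

text \<open>
  The underlying vector space is a linear subspace of some type of class \<open>real_vector\<close>; the
  relation \<open>ou_le\<close> is only relevant on the carrier.
\<close>

record 'a ou_space =
  ou_carrier :: "'a set"
  ou_le :: "'a \<Rightarrow> 'a \<Rightarrow> bool"
  ou_unit :: 'a

definition order_unit_space :: "'a::real_vector ou_space \<Rightarrow> bool" where
  "order_unit_space A \<longleftrightarrow>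
     subspace (ou_carrier A) \<and>
     partial_order_on (ou_carrier A) {(a, b) \<in> ou_carrier A \<times> ou_carrier A. ou_le A a b} \<and>
     (\<forall>a\<in>ou_carrier A. \<forall>b\<in>ou_carrier A. \<forall>c\<in>ou_carrier A.
        ou_le A a b \<longrightarrow> ou_le A (a + c) (b + c)) \<and>
     (\<forall>a\<in>ou_carrier A. \<forall>b\<in>ou_carrier A. \<forall>r\<ge>0.
        ou_le A a b \<longrightarrow> ou_le A (r *\<^sub>R a) (r *\<^sub>R b)) \<and>
     ou_unit A \<in> ou_carrier A \<and>
     (\<forall>a\<in>ou_carrier A. \<exists>r. ou_le A a (r *\<^sub>R ou_unit A)) \<and>
     (\<forall>a\<in>ou_carrier A. (\<forall>r>0. ou_le A a (r *\<^sub>R ou_unit A)) \<longrightarrow> ou_le A a 0)"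

definition ou_norm :: "'a::real_vector ou_space \<Rightarrow> 'a \<Rightarrow> real" where
  "ou_norm A a = Inf {r. ou_le A (- r *\<^sub>R ou_unit A) a \<and> ou_le A a (r *\<^sub>R ou_unit A)}"

text \<open>
  Functionals on the carrier are normalised to be \<open>undefined\<close> outside of it (\<open>extensional\<close>), so
  that they form a subset of the space \<open>powertop_real\<close> over the carrier.
\<close>

definition ou_dual :: "'a::real_vector ou_space \<Rightarrow> ('a \<Rightarrow> real) set" where
  "ou_dual A = {\<mu> \<in> extensional (ou_carrier A).
     (\<forall>a\<in>ou_carrier A. \<forall>b\<in>ou_carrier A. \<mu> (a + b) = \<mu> a + \<mu> b) \<and>
     (\<forall>a\<in>ou_carrier A. \<forall>r. \<mu> (r *\<^sub>R a) = r * \<mu> a) \<and>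
     (\<exists>K. \<forall>a\<in>ou_carrier A. \<bar>\<mu> a\<bar> \<le> K * ou_norm A a)}"

definition dual_norm :: "'a::real_vector ou_space \<Rightarrow> ('a \<Rightarrow> real) \<Rightarrow> real" where
  "dual_norm A \<mu> = (SUP a\<in>{a \<in> ou_carrier A. ou_norm A a \<le> 1}. \<bar>\<mu> a\<bar>)"

definition states :: "'a::real_vector ou_space \<Rightarrow> ('a \<Rightarrow> real) set" where
  "states A = {\<mu> \<in> ou_dual A. \<mu> (ou_unit A) = 1 \<and> dual_norm A \<mu> = 1}"

definition weak_star :: "'a::real_vector ou_space \<Rightarrow> ('a \<Rightarrow> real) topology" where
  "weak_star A = subtopology (powertop_real (ou_carrier A)) (states A)"


section \<open>Compact quantum metric spaces\<close>

definition seminorm_on :: "'a::real_vector set \<Rightarrow> ('a \<Rightarrow> real) \<Rightarrow> bool" where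
  "seminorm_on A L \<longleftrightarrow>
     (\<forall>a\<in>A. 0 \<le> L a) \<and>
     (\<forall>a\<in>A. \<forall>b\<in>A. L (a + b) \<le> L a + L b) \<and>
     (\<forall>a\<in>A. \<forall>r. L (r *\<^sub>R a) = \<bar>r\<bar> * L a)"

text \<open>For a general seminorm the supremum may be infinite, hence the extended reals.\<close>

definition state_dist ::
    "'a::real_vector ou_space \<Rightarrow> ('a \<Rightarrow> real) \<Rightarrow> ('a \<Rightarrow> real) \<Rightarrow> ('a \<Rightarrow> real) \<Rightarrow> ereal" where
  "state_dist A L \<mu> \<nu> = (SUP a\<in>{a \<in> ou_carrier A. L a \<le> 1}. ereal \<bar>\<mu> a - \<nu> a\<bar>)"

definition state_dist_topology ::
    "'a::real_vector ou_space \<Rightarrow> ('a \<Rightarrow> real) \<Rightarrow> ('a \<Rightarrow> real) topology" where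
  "state_dist_topology A L = topology (\<lambda>U. U \<subseteq> states A \<and>
     (\<forall>\<mu>\<in>U. \<exists>r>0. \<forall>\<nu>\<in>states A. state_dist A L \<mu> \<nu> < ereal r \<longrightarrow> \<nu> \<in> U))"

definition lip_norm :: "'a::real_vector ou_space \<Rightarrow> ('a \<Rightarrow> real) \<Rightarrow> bool" where
  "lip_norm A L \<longleftrightarrow>
     seminorm_on (ou_carrier A) L \<and>
     (\<forall>a\<in>ou_carrier A. L a = 0 \<longleftrightarrow> (\<exists>r. a = r *\<^sub>R ou_unit A)) \<and>
     state_dist_topology A L = weak_star A"

definition cqms :: "'a::real_vector ou_space \<Rightarrow> ('a \<Rightarrow> real) \<Rightarrow> bool" where
  "cqms A L \<longleftrightarrow> order_unit_space A \<and> lip_norm A L"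


section \<open>The norm completion, closedness and isometry\<close>

definition ou_Cauchy :: "'a::real_vector ou_space \<Rightarrow> (nat \<Rightarrow> 'a) set" where
  "ou_Cauchy A = {s. range s \<subseteq> ou_carrier A \<and>
     (\<forall>\<epsilon>>0. \<exists>N. \<forall>m\<ge>N. \<forall>n\<ge>N. ou_norm A (s m - s n) < \<epsilon>)}"

definition ou_Cauchy_rel :: "'a::real_vector ou_space \<Rightarrow> ((nat \<Rightarrow> 'a) \<times> (nat \<Rightarrow> 'a)) set" where
  "ou_Cauchy_rel A = {(s, t) \<in> ou_Cauchy A \<times> ou_Cauchy A.
     (\<lambda>n. ou_norm A (s n - t n)) \<longlonglongrightarrow> 0}"

definition completion :: "'a::real_vector ou_space \<Rightarrow> (nat \<Rightarrow> 'a) set set" where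
  "completion A = ou_Cauchy A // ou_Cauchy_rel A"

definition cincl :: "'a::real_vector ou_space \<Rightarrow> 'a \<Rightarrow> (nat \<Rightarrow> 'a) set" where
  "cincl A a = ou_Cauchy_rel A `` {\<lambda>_. a}"

definition cadd ::
    "'a::real_vector ou_space \<Rightarrow> (nat \<Rightarrow> 'a) set \<Rightarrow> (nat \<Rightarrow> 'a) set \<Rightarrow> (nat \<Rightarrow> 'a) set" where
  "cadd A S T = (\<Union>s\<in>S. \<Union>t\<in>T. ou_Cauchy_rel A `` {\<lambda>n. s n + t n})"

definition cscale ::
    "'a::real_vector ou_space \<Rightarrow> real \<Rightarrow> (nat \<Rightarrow> 'a) set \<Rightarrow> (nat \<Rightarrow> 'a) set" where
  "cscale A r S = (\<Union>s\<in>S. ou_Cauchy_rel A `` {\<lambda>n. r *\<^sub>R s n})"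

text \<open>The positive cone of the completion is the closure of the positive cone of \<open>A\<close>.\<close>

definition cle ::
    "'a::real_vector ou_space \<Rightarrow> (nat \<Rightarrow> 'a) set \<Rightarrow> (nat \<Rightarrow> 'a) set \<Rightarrow> bool" where
  "cle A S T \<longleftrightarrow> (\<exists>s\<in>S. \<exists>t\<in>T. \<forall>n. ou_le A (s n) (t n))"

definition cdist ::
    "'a::real_vector ou_space \<Rightarrow> (nat \<Rightarrow> 'a) set \<Rightarrow> (nat \<Rightarrow> 'a) set \<Rightarrow> real" where
  "cdist A S T = (THE d. \<exists>s\<in>S. \<exists>t\<in>T. (\<lambda>n. ou_norm A (s n - t n)) \<longlonglongrightarrow> d)"

definition Lbar ::
    "'a::real_vector ou_space \<Rightarrow> ('a \<Rightarrow> real) \<Rightarrow> (nat \<Rightarrow> 'a) set \<Rightarrow> ereal" where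
  "Lbar A L b = Inf {liminf (\<lambda>n. ereal (L (a n))) |a.
     range a \<subseteq> ou_carrier A \<and> (\<lambda>n. cdist A (cincl A (a n)) b) \<longlonglongrightarrow> 0}"

definition closure_carrier ::
    "'a::real_vector ou_space \<Rightarrow> ('a \<Rightarrow> real) \<Rightarrow> (nat \<Rightarrow> 'a) set set" where
  "closure_carrier A L = {b \<in> completion A. Lbar A L b < \<infinity>}"

definition cqms_closed :: "'a::real_vector ou_space \<Rightarrow> ('a \<Rightarrow> real) \<Rightarrow> bool" where
  "cqms_closed A L \<longleftrightarrow>
     cincl A ` ou_carrier A = closure_carrier A L \<and>
     (\<forall>a\<in>ou_carrier A. Lbar A L (cincl A a) = ereal (L a))"

definition cqms_isometric ::
    "'a::real_vector ou_space \<Rightarrow> ('a \<Rightarrow> real) \<Rightarrow> 'b::real_vector ou_space \<Rightarrow> ('b \<Rightarrow> real) \<Rightarrow> bool"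
where
  "cqms_isometric A LA B LB \<longleftrightarrow> (\<exists>\<phi>.
     bij_betw \<phi> (closure_carrier A LA) (closure_carrier B LB) \<and>
     (\<forall>S\<in>closure_carrier A LA. \<forall>T\<in>closure_carrier A LA.
        \<phi> (cadd A S T) = cadd B (\<phi> S) (\<phi> T)) \<and>
     (\<forall>S\<in>closure_carrier A LA. \<forall>r. \<phi> (cscale A r S) = cscale B r (\<phi> S)) \<and>
     (\<forall>S\<in>closure_carrier A LA. \<forall>T\<in>closure_carrier A LA. cle A S T \<longleftrightarrow> cle B (\<phi> S) (\<phi> T)) \<and>
     \<phi> (cincl A (ou_unit A)) = cincl B (ou_unit B) \<and>
     (\<forall>S\<in>closure_carrier A LA. Lbar A LA S = Lbar B LB (\<phi> S)))"


section \<open>Metrics on compact convex sets\<close>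

definition convex_metric :: "'v::real_vector set \<Rightarrow> ('v \<Rightarrow> 'v \<Rightarrow> real) \<Rightarrow> bool" where
  "convex_metric X \<rho> \<longleftrightarrow>
     (\<forall>\<mu>\<in>X. \<forall>\<nu>\<in>X. \<forall>\<mu>'\<in>X. \<forall>\<nu>'\<in>X. \<forall>t\<in>{0..1}.
        \<rho> (t *\<^sub>R \<mu> + (1 - t) *\<^sub>R \<mu>') (t *\<^sub>R \<nu> + (1 - t) *\<^sub>R \<nu>')
          \<le> t * \<rho> \<mu> \<nu> + (1 - t) * \<rho> \<mu>' \<nu>')"

definition midpoint_balanced :: "'v::real_vector set \<Rightarrow> ('v \<Rightarrow> 'v \<Rightarrow> real) \<Rightarrow> bool" where
  "midpoint_balanced X \<rho> \<longleftrightarrow>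
     (\<forall>\<mu>\<in>X. \<forall>\<nu>\<in>X. \<forall>\<mu>'\<in>X. \<forall>\<nu>'\<in>X.
        (1 / 2) *\<^sub>R (\<mu> + \<nu>') = (1 / 2) *\<^sub>R (\<mu>' + \<nu>) \<longrightarrow> \<rho> \<mu> \<nu> = \<rho> \<mu>' \<nu>')"

definition affinely_isometric ::
    "'v::real_vector set \<Rightarrow> ('v \<Rightarrow> 'v \<Rightarrow> real) \<Rightarrow> 'a::real_vector ou_space \<Rightarrow> ('a \<Rightarrow> real) \<Rightarrow> bool"
where
  "affinely_isometric X \<rho> A L \<longleftrightarrow> (\<exists>\<phi>.
     bij_betw \<phi> X (states A) \<and>
     (\<forall>x\<in>X. \<forall>y\<in>X. \<forall>t\<in>{0..1}. \<forall>a\<in>ou_carrier A.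
        \<phi> (t *\<^sub>R x + (1 - t) *\<^sub>R y) a = t * \<phi> x a + (1 - t) * \<phi> y a) \<and>
     (\<forall>x\<in>X. \<forall>y\<in>X. state_dist A L (\<phi> x) (\<phi> y) = ereal (\<rho> x y)))"

text \<open>
  Functions on \<open>X\<close> are represented by functions on the whole type that vanish outside \<open>X\<close>; this
  makes the following a linear subspace.
\<close>

definition Af :: "'v::locally_convex_t2_space set \<Rightarrow> ('v \<Rightarrow> real) set" where
  "Af X = {f. (\<forall>x. x \<notin> X \<longrightarrow> f x = 0) \<and> continuous_on X f \<and>
     (\<forall>x\<in>X. \<forall>y\<in>X. \<forall>t\<in>{0..1}. f (t *\<^sub>R x + (1 - t) *\<^sub>R y) = t * f x + (1 - t) * f y)}"

definition Af_Lip ::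
    "'v::locally_convex_t2_space set \<Rightarrow> ('v \<Rightarrow> 'v \<Rightarrow> real) \<Rightarrow> ('v \<Rightarrow> real) ou_space" where
  "Af_Lip X \<rho> = \<lparr>
     ou_carrier = {f \<in> Af X. Lipschitz_continuous_map (metric (X, \<rho>)) euclidean_metric f},
     ou_le = (\<lambda>f g. \<forall>x\<in>X. f x \<le> g x),
     ou_unit = (\<lambda>x. if x \<in> X then 1 else 0)\<rparr>"

text \<open>The \<open>insert 0\<close> makes the supremum \<open>0\<close> when \<open>X\<close> is a single point.\<close>

definition Lip_seminorm :: "'v set \<Rightarrow> ('v \<Rightarrow> 'v \<Rightarrow> real) \<Rightarrow> ('v \<Rightarrow> real) \<Rightarrow> real" where
  "Lip_seminorm X \<rho> f =
     Sup (insert 0 {\<bar>f x - f y\<bar> / \<rho> x y |x y. x \<in> X \<and> y \<in> X \<and> x \<noteq> y})"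

end

theory Submission
  imports Defs
begin

text \<open>
  In one direction, the distance of two states is a supremum of the terms \<open>\<bar>\<mu> a - \<nu> a\<bar>\<close>, each of
  which is a convex function of the difference \<open>\<mu> - \<nu>\<close>; hence the metric is convex and depends only
  on this difference, that is, it is midpoint-balanced (\<open>affinely_isometric_metric\<close>).

  Conversely, a convex and midpoint-balanced metric is the restriction of a seminorm
  \<open>t (x - y) \<mapsto> t \<rho> x y\<close> on the linear span of \<open>X - X\<close>.  By the Hahn--Banach theorem every distance
  \<open>\<rho> x y\<close> is the difference \<open>f x - f y\<close> for some affine \<open>f\<close> with Lipschitz constant at most \<open>1\<close>
  (\<open>norming_function\<close>).  In particular the Lipschitz affine functions separate the points of \<open>X\<close>.
  Their states are exactly the evaluations at points of \<open>X\<close> (\<open>state_is_evaluation\<close>), evaluation is a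
  homeomorphism onto the state space by compactness, and the state metric of the Lipschitz seminorm
  is \<open>\<rho>\<close>.  So \<open>Af_Lip X \<rho>\<close> is a compact quantum metric space with state space \<open>X\<close>.

  For uniqueness, let \<open>X\<close> be isometric to the state space of some \<open>(A, L)\<close>.  States determine the order
  of \<open>A\<close> (\<open>le_if_states\<close>) and hence its norm, so the elements of \<open>A\<close> are affine functions on \<open>X\<close>
  with the pointwise order and the supremum norm, and elements of the completion are uniform limits
  of such functions.  The estimate \<open>\<bar>a x - a y\<bar> \<le> L a \<rho> x y\<close> passes to these limits, so an
  element of the closure is a Lipschitz function whose Lipschitz constant is at most its closed
  seminorm.  For the reverse inequality each Lipschitz affine \<open>f\<close> has to be approximated uniformly
  by elements \<open>a\<close> of \<open>A\<close> with \<open>L a \<le> Lip f\<close> (\<open>approximation\<close>); at a single pair of points the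
  difference of \<open>f\<close> is matched by such elements because \<open>\<rho>\<close> is the state metric.  Thus the closure of \<open>A\<close> is always the space of
  Lipschitz affine functions with the Lipschitz seminorm (\<open>bij_cls\<close>, \<open>Lbar_eq_Lip\<close>), and two such
  spaces are isometric.  Applied to \<open>Af_Lip X \<rho>\<close> itself, the same description shows that this space
  is closed.

  Both the representation of states by points and the approximation have the form of a minimax
  statement: pointwise choices from a convex family of affine functions on a compact convex set are
  to be replaced by a single choice that works everywhere.  This is \<open>affine_alternative\<close>, applied on
  \<open>X\<close> in the first case and on \<open>X \<times> X\<close> in the second.
\<close>


section \<open>Sublinear functionals and the Hahn--Banach theorem\<close>

definition sublinear :: "('a::real_vector \<Rightarrow> real) \<Rightarrow> bool" where
  "sublinear p \<longleftrightarrow>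
     (\<forall>x y. p (x + y) \<le> p x + p y) \<and> (\<forall>r x. 0 \<le> r \<longrightarrow> p (r *\<^sub>R x) = r * p x)"

lemma sublinear_add: "sublinear p \<Longrightarrow> p (x + y) \<le> p x + p y"
  and sublinear_scale: "sublinear p \<Longrightarrow> 0 \<le> r \<Longrightarrow> p (r *\<^sub>R x) = r * p x"
  by (auto simp: sublinear_def)

lemma sublinear_0: "sublinear p \<Longrightarrow> p 0 = 0"
  using sublinear_scale[of p 0 0] by simp

lemma sublinear_minus_le: "sublinear p \<Longrightarrow> - p (- x) \<le> p x"
  using sublinear_add[of p x "- x"] sublinear_0[of p] by simp

lemma sublinearI:
  assumes add: "\<And>x y. p (x + y) \<le> p x + p y"
    and scale: "\<And>r x. 0 < r \<Longrightarrow> p (r *\<^sub>R x) \<le> r * p x"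
    and zero: "p 0 = 0"
  shows "sublinear p"
proof -
  have "p (r *\<^sub>R x) = r * p x" if "0 \<le> r" for r x
  proof (cases "r = 0")
    case False
    with that have r: "0 < r" by simp
    have "p (inverse r *\<^sub>R r *\<^sub>R x) \<le> inverse r * p (r *\<^sub>R x)"
      using r by (intro scale) simp
    then have "r * p x \<le> p (r *\<^sub>R x)"
      using r by (simp add: field_simps)
    with scale[OF r, of x] show ?thesis by simp
  qed (simp add: zero)
  with add show ?thesis by (auto simp: sublinear_def)
qed

text \<open>
  A sublinear \<open>p\<close> can be lowered until it takes the value \<open>- p z\<close> at \<open>- z\<close>: subtract from
  \<open>p (x + t z)\<close> what the move by \<open>t z\<close> costs, and optimise over \<open>t\<close>.
\<close>

lemma sublinear_tilt:
  assumes p: "sublinear p"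
  obtains q where "sublinear q" "\<And>x. q x \<le> p x" "q (- z) \<le> - p z"
proof
  define S where "S x = (\<lambda>t. p (x + t *\<^sub>R z) - t * p z) ` {0..}" for x
  define q where "q x = Inf (S x)" for x
  have lb: "- p (- x) \<le> p (x + t *\<^sub>R z) - t * p z" if "0 \<le> t" for x t
    using sublinear_add[OF p, of "x + t *\<^sub>R z" "- x"] sublinear_scale[OF p that, of z] by simp
  have bdd: "bdd_below (S x)" for x
    using lb by (auto simp: S_def intro!: bdd_belowI[of _ "- p (- x)"])
  have le: "q x \<le> p (x + t *\<^sub>R z) - t * p z" if "0 \<le> t" for x t
    unfolding q_def using that by (intro cInf_lower bdd) (auto simp: S_def)
  have greatest: "c \<le> q x" if "\<And>t. 0 \<le> t \<Longrightarrow> c \<le> p (x + t *\<^sub>R z) - t * p z" for c x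
    unfolding q_def using that by (intro cInf_greatest) (auto simp: S_def)
  show "q x \<le> p x" for x
    using le[of 0 x] by simp
  show "q (- z) \<le> - p z"
    using le[of 1 "- z"] sublinear_0[OF p] by simp
  show "sublinear q"
  proof (rule sublinearI)
    fix x y
    have "q (x + y) - (p (y + t *\<^sub>R z) - t * p z) \<le> p (x + s *\<^sub>R z) - s * p z"
      if "0 \<le> s" "0 \<le> t" for s t
      using le[of "s + t" "x + y"] sublinear_add[OF p, of "x + s *\<^sub>R z" "y + t *\<^sub>R z"] that
      by (simp add: algebra_simps)
    then have "q (x + y) - (p (y + t *\<^sub>R z) - t * p z) \<le> q x" if "0 \<le> t" for t
      using that by (intro greatest) auto
    then have "q (x + y) - q x \<le> q y"
      by (intro greatest) (auto simp: algebra_simps)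
    then show "q (x + y) \<le> q x + q y" by simp
  next
    fix r :: real and x assume r: "0 < r"
    have "q (r *\<^sub>R x) / r \<le> q x"
    proof (rule greatest)
      fix t :: real assume t: "0 \<le> t"
      have "p (r *\<^sub>R x + (r * t) *\<^sub>R z) = r * p (x + t *\<^sub>R z)"
        using sublinear_scale[OF p, of r "x + t *\<^sub>R z"] r by (simp add: scaleR_add_right)
      with le[of "r * t" "r *\<^sub>R x"] r t show "q (r *\<^sub>R x) / r \<le> p (x + t *\<^sub>R z) - t * p z"
        by (simp add: field_simps)
    qed
    with r show "q (r *\<^sub>R x) \<le> r * q x" by (simp add: field_simps)
  next
    show "q 0 = 0"
      using le[of 0 0] greatest[of 0 0] lb[of _ 0] sublinear_0[OF p] by (intro antisym) auto
  qed
qed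

text \<open>
  The infimum is finite because \<open>- p0 (- x)\<close>, for a fixed member \<open>p0\<close>, is a lower bound for the
  values at \<open>x\<close> of all functionals comparable with \<open>p0\<close>.
\<close>

lemma sublinear_Inf_chain:
  assumes C: "C \<noteq> {}" "\<And>p. p \<in> C \<Longrightarrow> sublinear p"
    and chain: "\<And>p q. p \<in> C \<Longrightarrow> q \<in> C \<Longrightarrow> p \<le> q \<or> q \<le> p"
  shows "sublinear (\<lambda>x. INF p\<in>C. p x)" (is "sublinear ?q")
    and "p \<in> C \<Longrightarrow> (INF p\<in>C. p x) \<le> p x"
proof -
  obtain p0 where p0: "p0 \<in> C" using C(1) by blast
  have lb: "- p0 (- x) \<le> p x" if p: "p \<in> C" for p x
  proof (cases "p \<le> p0")
    case True
    then show ?thesis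
      using sublinear_minus_le[OF C(2)[OF p], of x] le_funD[OF True, of "- x"] by simp
  next
    case False
    then have "p0 x \<le> p x" using chain[OF p p0] by (auto simp: le_fun_def)
    then show ?thesis using sublinear_minus_le[OF C(2)[OF p0], of x] by simp
  qed
  have bdd: "bdd_below ((\<lambda>p. p x) ` C)" for x
    using lb by (auto intro!: bdd_belowI[of _ "- p0 (- x)"])
  show le: "?q x \<le> p x" if "p \<in> C" for p x
    by (rule cINF_lower[OF bdd that])
  have greatest: "c \<le> ?q x" if "\<And>p. p \<in> C \<Longrightarrow> c \<le> p x" for c x
    using C(1) that by (rule cINF_greatest)
  show "sublinear ?q"
  proof (rule sublinearI)
    fix x y
    have *: "?q (x + y) \<le> p x + p' y" if p: "p \<in> C" "p' \<in> C" for p p'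
    proof -
      obtain r where "r \<in> C" "r x \<le> p x" "r y \<le> p' y"
        using chain[OF p] p unfolding le_fun_def by blast
      with le[of r "x + y"] sublinear_add[OF C(2), of r x y] show ?thesis by simp
    qed
    have "?q (x + y) - p' y \<le> ?q x" if "p' \<in> C" for p'
      using *[OF _ that] by (intro greatest) (simp add: algebra_simps)
    then have "?q (x + y) - ?q x \<le> ?q y"
      by (intro greatest) (simp add: algebra_simps)
    then show "?q (x + y) \<le> ?q x + ?q y" by simp
  next
    fix r :: real and x assume r: "0 < r"
    have "?q (r *\<^sub>R x) / r \<le> ?q x"
      using le[of _ "r *\<^sub>R x"] sublinear_scale[OF C(2), of _ r x] r
      by (intro greatest) (simp add: field_simps)
    with r show "?q (r *\<^sub>R x) \<le> r * ?q x" by (simp add: field_simps)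
  next
    have "(\<lambda>p. p 0) ` C = {0}" using p0 sublinear_0[OF C(2)] by force
    then show "?q 0 = 0" by simp
  qed
qed

text \<open>
  By Zorn's lemma there is a minimal sublinear functional below \<open>p\<close>.  Tilting cannot lower it
  further, so it is odd, hence linear.
\<close>

lemma linear_below_sublinear:
  assumes p: "sublinear p"
  obtains f where "linear f" "\<And>x. f x \<le> p x"
proof -
  define M where "M = {q. sublinear q \<and> q \<le> p}"
  let ?R = "\<lambda>f g. g \<le> (f :: 'a \<Rightarrow> real)"
  have "\<exists>m\<in>M. \<forall>a\<in>M. ?R m a \<longrightarrow> a = m"
  proof (rule predicate_Zorn)
    show "partial_order_on M (relation_of ?R M)"
      by (rule partial_order_on_relation_ofI) auto
    show "\<exists>u\<in>M. \<forall>a\<in>C. ?R a u" if C: "C \<in> Chains (relation_of ?R M)" for C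
    proof (cases "C = {}")
      case True
      with p show ?thesis by (auto simp: M_def)
    next
      case False
      have sub: "C \<subseteq> M" and chain: "\<And>f g. f \<in> C \<Longrightarrow> g \<in> C \<Longrightarrow> f \<le> g \<or> g \<le> f"
        using C by (auto simp: Chains_def relation_of_def)
      have sl: "sublinear f" if "f \<in> C" for f
        using sub that by (auto simp: M_def)
      note inf = sublinear_Inf_chain[OF False sl chain]
      obtain f where "f \<in> C" using False by blast
      then have "(\<lambda>x. INF p\<in>C. p x) \<le> p"
        using inf(2)[of f] sub by (auto simp: M_def le_fun_def intro: order_trans)
      with inf show ?thesis
        by (intro bexI[of _ "\<lambda>x. INF p\<in>C. p x"]) (auto simp: M_def le_fun_def)
    qed
  qed
  then obtain f where f: "sublinear f" "f \<le> p" and min: "\<And>q. sublinear q \<Longrightarrow> q \<le> f \<Longrightarrow> q = f"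
    by (auto simp: M_def)
  have odd: "f (- x) = - f x" for x
  proof -
    obtain q where q: "sublinear q" "\<And>y. q y \<le> f y" "q (- x) \<le> - f x"
      using sublinear_tilt[OF f(1), of x] by blast
    have "q = f" using q(2) by (intro min q(1)) (auto simp: le_fun_def)
    with q(3) sublinear_minus_le[OF f(1), of x] show ?thesis by simp
  qed
  have "linear f"
  proof (rule linearI)
    show "f (x + y) = f x + f y" for x y
      using sublinear_add[OF f(1), of x y] sublinear_add[OF f(1), of "- x" "- y"]
      by (simp add: odd[of "x + y", simplified] odd)
    show "f (r *\<^sub>R x) = r *\<^sub>R f x" for r x
    proof (cases "0 \<le> r")
      case True
      with f(1) show ?thesis by (simp add: sublinear_scale)
    next
      case False
      then show ?thesis
        using sublinear_scale[OF f(1), of "- r" x] odd[of "r *\<^sub>R x"] by simp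
    qed
  qed
  with f(2) show thesis by (intro that) (auto simp: le_fun_def)
qed

text \<open>
  A linear projection of the whole type onto \<open>W\<close> reduces the case of a functional that is only
  sublinear on \<open>W\<close> to that of a globally sublinear one.
\<close>

theorem Hahn_Banach_subspace:
  fixes p :: "'a::real_vector \<Rightarrow> real"
  assumes W: "subspace W"
    and add: "\<And>x y. x \<in> W \<Longrightarrow> y \<in> W \<Longrightarrow> p (x + y) \<le> p x + p y"
    and scale: "\<And>r x. 0 < r \<Longrightarrow> x \<in> W \<Longrightarrow> p (r *\<^sub>R x) \<le> r * p x"
    and zero: "p 0 = 0"
    and z: "z \<in> W"
  obtains f where "linear f" "\<And>x. x \<in> W \<Longrightarrow> f x \<le> p x" "f z = p z"
proof -
  obtain P :: "'a \<Rightarrow> 'a" where P: "range P \<subseteq> W" "linear P" "\<And>x. x \<in> W \<Longrightarrow> P x = x"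
    using linear_exists_left_inverse_on[OF linear_id W] by auto
  have tilt: "sublinear (p \<circ> P)"
    using P(1) by (intro sublinearI)
      (auto simp: linear_add[OF P(2)] linear_scale[OF P(2)] linear_0[OF P(2)] zero
        intro!: add scale)
  obtain q where q: "sublinear q" "\<And>x. q x \<le> (p \<circ> P) x" "q (- z) \<le> - (p \<circ> P) z"
    using sublinear_tilt[OF tilt, of z] by blast
  obtain f where f: "linear f" "\<And>x. f x \<le> q x"
    using linear_below_sublinear[OF q(1)] by blast
  have le: "f x \<le> p x" if "x \<in> W" for x
    using f(2)[of x] q(2)[of x] P(3)[OF that] by simp
  moreover have "f z = p z"
    using f(2)[of "- z"] q(3) le[OF z] P(3)[OF z] linear_neg[OF f(1), of z] by simp
  ultimately show thesis using f(1) that by blast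
qed


section \<open>A theorem of the alternative for affine functions\<close>

definition affine_fun_on :: "'z::real_vector set \<Rightarrow> ('z \<Rightarrow> real) \<Rightarrow> bool" where
  "affine_fun_on Z u \<longleftrightarrow>
     (\<forall>x\<in>Z. \<forall>y\<in>Z. \<forall>t\<in>{0..1}. u (t *\<^sub>R x + (1 - t) *\<^sub>R y) = t * u x + (1 - t) * u y)"

lemma affine_fun_onD:
  assumes "affine_fun_on Z u" "x \<in> Z" "y \<in> Z" "0 \<le> t" "t \<le> 1"
  shows "u (t *\<^sub>R x + (1 - t) *\<^sub>R y) = t * u x + (1 - t) * u y"
  using assms by (auto simp: affine_fun_on_def)

lemma affine_fun_on_const [simp]: "affine_fun_on Z (\<lambda>z. k)"
  by (auto simp: affine_fun_on_def algebra_simps)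

lemma affine_fun_on_add:
  assumes u: "affine_fun_on Z u" and v: "affine_fun_on Z v"
  shows "affine_fun_on Z (\<lambda>z. u z + v z)"
  unfolding affine_fun_on_def
proof (intro ballI)
  fix x y and t :: real assume "x \<in> Z" "y \<in> Z" "t \<in> {0..1}"
  then have *: "x \<in> Z" "y \<in> Z" "0 \<le> t" "t \<le> 1" by auto
  show "u (t *\<^sub>R x + (1 - t) *\<^sub>R y) + v (t *\<^sub>R x + (1 - t) *\<^sub>R y) =
      t * (u x + v x) + (1 - t) * (u y + v y)"
    unfolding affine_fun_onD[OF u *] affine_fun_onD[OF v *] by (simp add: algebra_simps)
qed

lemma affine_fun_on_scale:
  assumes u: "affine_fun_on Z u"
  shows "affine_fun_on Z (\<lambda>z. r * u z)"
  unfolding affine_fun_on_def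
proof (intro ballI)
  fix x y and t :: real assume "x \<in> Z" "y \<in> Z" "t \<in> {0..1}"
  then have *: "x \<in> Z" "y \<in> Z" "0 \<le> t" "t \<le> 1" by auto
  show "r * u (t *\<^sub>R x + (1 - t) *\<^sub>R y) = t * (r * u x) + (1 - t) * (r * u y)"
    unfolding affine_fun_onD[OF u *] by (simp add: algebra_simps)
qed

lemma affine_fun_on_diff:
  assumes "affine_fun_on Z u" "affine_fun_on Z v"
  shows "affine_fun_on Z (\<lambda>z. u z - v z)"
  using affine_fun_on_add[OF assms(1) affine_fun_on_scale[OF assms(2), of "- 1"]] by simp

text \<open>
  The case of finitely many functions asks to separate the compact convex image of \<open>Z\<close> from the
  nonnegative orthant.  The coefficients are the negative parts of the \<open>u i\<close> at the point of \<open>Z\<close>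
  whose image is nearest to the orthant; moving from there towards any other point cannot decrease
  the distance, and the first-order form of this is the separating inequality.
\<close>

lemma affine_alternative_finite:
  fixes u :: "'i \<Rightarrow> 'z::{real_vector,topological_space} \<Rightarrow> real"
  assumes Z: "compact Z" "convex Z" "Z \<noteq> {}" and I: "finite I"
    and cont: "\<And>i. i \<in> I \<Longrightarrow> continuous_on Z (u i)"
    and aff: "\<And>i. i \<in> I \<Longrightarrow> affine_fun_on Z (u i)"
    and none: "\<And>z. z \<in> Z \<Longrightarrow> \<exists>i\<in>I. u i z < 0"
  obtains c where "\<And>i. 0 \<le> c i" "\<And>z. z \<in> Z \<Longrightarrow> (\<Sum>i\<in>I. c i * u i z) < 0"
proof -
  define \<Phi> where "\<Phi> z = (\<Sum>i\<in>I. (max 0 (- u i z))\<^sup>2)" for z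
  have "continuous_on Z \<Phi>"
    unfolding \<Phi>_def by (intro continuous_intros cont)
  then obtain z0 where z0: "z0 \<in> Z" and min: "\<And>z. z \<in> Z \<Longrightarrow> \<Phi> z0 \<le> \<Phi> z"
    using continuous_attains_inf[OF Z(1,3)] by blast
  define c where "c i = max 0 (- u i z0)" for i
  have c2: "c i * u i z0 = - (c i)\<^sup>2" for i
    by (simp add: c_def max_def power2_eq_square)
  have le: "(\<Sum>i\<in>I. c i * (u i z - u i z0)) \<le> 0" if z: "z \<in> Z" for z
  proof -
    define d where "d i = u i z - u i z0" for i
    have "2 * (\<Sum>i\<in>I. c i * d i) \<le> t * (\<Sum>i\<in>I. (d i)\<^sup>2)" if t: "0 < t" "t \<le> 1" for t
    proof -
      have "\<Phi> z0 \<le> \<Phi> (t *\<^sub>R z + (1 - t) *\<^sub>R z0)"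
        using t z z0 Z(2) by (intro min convexD) auto
      also have "\<dots> \<le> (\<Sum>i\<in>I. (c i - t * d i)\<^sup>2)"
        unfolding \<Phi>_def
      proof (rule sum_mono)
        fix i assume i: "i \<in> I"
        \<comment> \<open>\<open>u i z0 + c i \<ge> 0\<close> is a coordinate of the point of the orthant nearest to the image of
          \<open>z0\<close>; the distance of the moved image from this same point bounds its distance from the
          orthant.\<close>
        have "u i (t *\<^sub>R z + (1 - t) *\<^sub>R z0) = u i z0 + t * d i"
          using affine_fun_onD[OF aff[OF i] z z0, of t] t by (simp add: d_def algebra_simps)
        moreover have "- u i z0 \<le> c i" by (simp add: c_def)
        ultimately have "max 0 (- u i (t *\<^sub>R z + (1 - t) *\<^sub>R z0)) \<le> \<bar>c i - t * d i\<bar>" by simp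
        then have "(max 0 (- u i (t *\<^sub>R z + (1 - t) *\<^sub>R z0)))\<^sup>2 \<le> \<bar>c i - t * d i\<bar>\<^sup>2"
          by (intro power_mono) auto
        then show "(max 0 (- u i (t *\<^sub>R z + (1 - t) *\<^sub>R z0)))\<^sup>2 \<le> (c i - t * d i)\<^sup>2" by simp
      qed
      also have "\<dots> = \<Phi> z0 - t * (2 * (\<Sum>i\<in>I. c i * d i)) + t * (t * (\<Sum>i\<in>I. (d i)\<^sup>2))"
        by (simp add: \<Phi>_def c_def[symmetric] power2_eq_square algebra_simps sum.distrib
            sum_subtractf sum_distrib_left)
      finally have "t * (2 * (\<Sum>i\<in>I. c i * d i)) \<le> t * (t * (\<Sum>i\<in>I. (d i)\<^sup>2))" by simp
      with t(1) show ?thesis by (simp only: mult_le_cancel_left_pos)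
    qed
    then have "\<forall>\<^sub>F t in at_right 0. 2 * (\<Sum>i\<in>I. c i * d i) \<le> t * (\<Sum>i\<in>I. (d i)\<^sup>2)"
      by (auto simp: eventually_at_right_field intro!: exI[of _ 1])
    moreover have "((\<lambda>t. t * (\<Sum>i\<in>I. (d i)\<^sup>2)) \<longlongrightarrow> 0 * (\<Sum>i\<in>I. (d i)\<^sup>2)) (at_right (0::real))"
      by (intro tendsto_intros)
    ultimately have "2 * (\<Sum>i\<in>I. c i * d i) \<le> 0 * (\<Sum>i\<in>I. (d i)\<^sup>2)"
      by (intro tendsto_le[OF _ _ tendsto_const]) auto
    then show ?thesis by (simp add: d_def)
  qed
  obtain j where j: "j \<in> I" "u j z0 < 0" using none[OF z0] by blast
  have "0 < (\<Sum>i\<in>I. (c i)\<^sup>2)"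
    using j I by (intro sum_pos2[of _ j]) (auto simp: c_def)
  then have "(\<Sum>i\<in>I. c i * u i z) < 0" if "z \<in> Z" for z
    using le[OF that] by (simp add: right_diff_distrib sum_subtractf sum.distrib c2 sum_negf)
  then show thesis by (intro that[of c]) (auto simp: c_def)
qed

text \<open>Compactness of \<open>Z\<close> reduces an arbitrary family to a finite one.\<close>

lemma affine_alternative:
  fixes u :: "'i \<Rightarrow> 'z::{real_vector,topological_space} \<Rightarrow> real"
  assumes Z: "compact Z" "convex Z" "Z \<noteq> {}"
    and cont: "\<And>i. i \<in> I \<Longrightarrow> continuous_on Z (u i)"
    and aff: "\<And>i. i \<in> I \<Longrightarrow> affine_fun_on Z (u i)"
    and none: "\<And>z. z \<in> Z \<Longrightarrow> \<exists>i\<in>I. u i z < 0"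
  obtains F c where "finite F" "F \<subseteq> I" "\<And>i. 0 \<le> c i"
    "\<And>z. z \<in> Z \<Longrightarrow> (\<Sum>i\<in>F. c i * u i z) < 0"
proof -
  have "\<exists>G. open G \<and> G \<inter> Z = {z \<in> Z. u i z < 0}" if "i \<in> I" for i
  proof -
    have "openin (top_of_set Z) (Z \<inter> u i -` {..<0})"
      using cont[OF that] by (intro continuous_openin_preimage_gen) auto
    then show ?thesis by (auto simp: openin_open)
  qed
  then obtain G where G: "\<And>i. i \<in> I \<Longrightarrow> open (G i)"
      "\<And>i. i \<in> I \<Longrightarrow> G i \<inter> Z = {z \<in> Z. u i z < 0}"
    by metis
  have "Z \<subseteq> (\<Union>i\<in>I. G i)" using none G(2) by fastforce
  then obtain F where F: "F \<subseteq> I" "finite F" "Z \<subseteq> (\<Union>i\<in>F. G i)"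
    using compactE_image[OF Z(1), of I G] G(1) by blast
  have "\<exists>i\<in>F. u i z < 0" if "z \<in> Z" for z
    using F(1,3) G(2) that by blast
  then obtain c where "\<And>i. 0 \<le> c i" "\<And>z. z \<in> Z \<Longrightarrow> (\<Sum>i\<in>F. c i * u i z) < 0"
    using affine_alternative_finite[OF Z F(2), of u] F(1) cont aff by blast
  with F show thesis using that by blast
qed


section \<open>Order-unit spaces and their states\<close>

locale order_unit =
  fixes A :: "'a::real_vector ou_space"
  assumes ou: "order_unit_space A"
begin

abbreviation car :: "'a set" where "car \<equiv> ou_carrier A"
abbreviation le :: "'a \<Rightarrow> 'a \<Rightarrow> bool"  (infix \<open>\<preceq>\<close> 50) where "a \<preceq> b \<equiv> ou_le A a b"
abbreviation unit :: 'a  (\<open>\<e>\<close>) where "\<e> \<equiv> ou_unit A"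

lemma subspace_car: "subspace car"
  and unit_in [simp]: "\<e> \<in> car"
  and le_add: "a \<in> car \<Longrightarrow> b \<in> car \<Longrightarrow> c \<in> car \<Longrightarrow> a \<preceq> b \<Longrightarrow> a + c \<preceq> b + c"
  and le_scale: "a \<in> car \<Longrightarrow> b \<in> car \<Longrightarrow> 0 \<le> r \<Longrightarrow> a \<preceq> b \<Longrightarrow> r *\<^sub>R a \<preceq> r *\<^sub>R b"
  and unit_bound: "a \<in> car \<Longrightarrow> \<exists>r. a \<preceq> r *\<^sub>R \<e>"
  and archimedean: "a \<in> car \<Longrightarrow> (\<And>r. 0 < r \<Longrightarrow> a \<preceq> r *\<^sub>R \<e>) \<Longrightarrow> a \<preceq> 0"
  using ou by (auto simp: order_unit_space_def)

lemma car_simps [simp]: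
  "0 \<in> car" "a \<in> car \<Longrightarrow> b \<in> car \<Longrightarrow> a + b \<in> car" "a \<in> car \<Longrightarrow> b \<in> car \<Longrightarrow> a - b \<in> car"
  "a \<in> car \<Longrightarrow> r *\<^sub>R a \<in> car" "a \<in> car \<Longrightarrow> - a \<in> car"
  using subspace_car
  by (auto intro: subspace_0 subspace_add subspace_diff subspace_scale subspace_neg)

lemma le_refl: "a \<in> car \<Longrightarrow> a \<preceq> a"
  and le_antisym: "a \<in> car \<Longrightarrow> b \<in> car \<Longrightarrow> a \<preceq> b \<Longrightarrow> b \<preceq> a \<Longrightarrow> a = b"
  and le_trans: "a \<in> car \<Longrightarrow> b \<in> car \<Longrightarrow> c \<in> car \<Longrightarrow> a \<preceq> b \<Longrightarrow> b \<preceq> c \<Longrightarrow> a \<preceq> c"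
proof -
  have po: "partial_order_on car {(a, b) \<in> car \<times> car. a \<preceq> b}"
    using ou by (simp add: order_unit_space_def)
  show "a \<in> car \<Longrightarrow> a \<preceq> a"
    using po by (auto simp: partial_order_on_def preorder_on_def refl_on_def)
  show "a \<in> car \<Longrightarrow> b \<in> car \<Longrightarrow> a \<preceq> b \<Longrightarrow> b \<preceq> a \<Longrightarrow> a = b"
    using po by (auto simp: partial_order_on_def antisym_def)
  show "a \<in> car \<Longrightarrow> b \<in> car \<Longrightarrow> c \<in> car \<Longrightarrow> a \<preceq> b \<Longrightarrow> b \<preceq> c \<Longrightarrow> a \<preceq> c"
    using po unfolding partial_order_on_def preorder_on_def trans_def by blast
qed

lemma le_iff_diff: "a \<in> car \<Longrightarrow> b \<in> car \<Longrightarrow> a \<preceq> b \<longleftrightarrow> 0 \<preceq> b - a"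
  using le_add[of a b "- a"] le_add[of 0 "b - a" a] by auto

lemma le_add_mono:
  assumes "a \<in> car" "b \<in> car" "c \<in> car" "d \<in> car" "a \<preceq> b" "c \<preceq> d"
  shows "a + c \<preceq> b + d"
  using le_trans[of "a + c" "b + c" "b + d"] le_add[of a b c] le_add[of c d b] assms
  by (simp add: add.commute)

lemma le_scale_iff:
  assumes "a \<in> car" "b \<in> car" "0 < r"
  shows "r *\<^sub>R a \<preceq> r *\<^sub>R b \<longleftrightarrow> a \<preceq> b"
  using le_scale[of a b r] le_scale[of "r *\<^sub>R a" "r *\<^sub>R b" "inverse r"] assms by auto

lemma state_simps:
  assumes "\<mu> \<in> states A"
  shows "a \<in> car \<Longrightarrow> b \<in> car \<Longrightarrow> \<mu> (a + b) = \<mu> a + \<mu> b"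
    and "a \<in> car \<Longrightarrow> \<mu> (r *\<^sub>R a) = r * \<mu> a"
    and "a \<in> car \<Longrightarrow> b \<in> car \<Longrightarrow> \<mu> (a - b) = \<mu> a - \<mu> b"
    and "\<mu> \<e> = 1"
    and "\<mu> \<in> extensional car"
proof -
  have lin: "\<forall>a\<in>car. \<forall>b\<in>car. \<mu> (a + b) = \<mu> a + \<mu> b" "\<forall>a\<in>car. \<forall>r. \<mu> (r *\<^sub>R a) = r * \<mu> a"
    using assms by (auto simp: states_def ou_dual_def)
  show "a \<in> car \<Longrightarrow> b \<in> car \<Longrightarrow> \<mu> (a - b) = \<mu> a - \<mu> b"
    using lin(1)[rule_format, of a "(- 1) *\<^sub>R b"] lin(2)[rule_format, of b "- 1"] by simp
qed (use assms in \<open>auto simp: states_def ou_dual_def\<close>)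

lemma state_sum:
  assumes \<mu>: "\<mu> \<in> states A" and F: "finite F" "F \<subseteq> car"
  shows "(\<Sum>a\<in>F. c a *\<^sub>R a) \<in> car" and "\<mu> (\<Sum>a\<in>F. c a *\<^sub>R a) = (\<Sum>a\<in>F. c a * \<mu> a)"
proof -
  have "(\<Sum>a\<in>F. c a *\<^sub>R a) \<in> car \<and> \<mu> (\<Sum>a\<in>F. c a *\<^sub>R a) = (\<Sum>a\<in>F. c a * \<mu> a)"
    using F state_simps(2)[OF \<mu>, of 0 0] by induction (auto simp: state_simps(1,2)[OF \<mu>])
  then show "(\<Sum>a\<in>F. c a *\<^sub>R a) \<in> car" "\<mu> (\<Sum>a\<in>F. c a *\<^sub>R a) = (\<Sum>a\<in>F. c a * \<mu> a)"
    by auto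
qed

text \<open>
  The axioms quantify over all real multiples of \<open>\<e>\<close> and do not force \<open>0 \<preceq> \<e>\<close>: the real line
  with the order unit \<open>-1\<close>, or with the discrete order, satisfies them.  In such a space the sets
  whose infimum is the norm are empty or unbounded below on the positive multiples of \<open>\<e>\<close>, so the
  norm is constant there and no linear functional with \<open>\<mu> \<e> = 1\<close> is bounded.
\<close>

lemma unit_pos_if_state:
  assumes \<mu>: "\<mu> \<in> states A"
  shows "0 \<preceq> \<e>" and "\<e> \<noteq> 0"
proof -
  show nz: "\<e> \<noteq> 0"
    using state_simps(4)[OF \<mu>] state_simps(2)[OF \<mu>, of 0 0] by auto
  show "0 \<preceq> \<e>"
  proof (rule ccontr)
    assume neg: "\<not> 0 \<preceq> \<e>"
    have pos_iff: "0 \<preceq> s *\<^sub>R \<e> \<longleftrightarrow> s = 0 \<or> (s < 0 \<and> \<e> \<preceq> 0)" for s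
    proof -
      consider "s = 0" | "0 < s" | "s < 0" by linarith
      then show ?thesis
      proof cases
        case 1
        then show ?thesis by (simp add: le_refl)
      next
        case 2
        then show ?thesis using le_scale_iff[of 0 \<e> s] neg by simp
      next
        case 3
        then show ?thesis
          using le_scale_iff[of 0 "- \<e>" "- s"] le_iff_diff[of \<e> 0] by simp
      qed
    qed
    \<comment> \<open>The values that the norm takes on positive multiples of \<open>\<e>\<close>: the default values of \<open>Inf\<close>
      for sets of reals that are unbounded below and for the empty set.\<close>
    define k where "k = (if \<e> \<preceq> 0 then - (LEAST z::real. False) else Inf {})"
    have norm: "ou_norm A (t *\<^sub>R \<e>) = k" if t: "0 < t" for t
    proof -
      have "{r. - r *\<^sub>R \<e> \<preceq> t *\<^sub>R \<e> \<and> t *\<^sub>R \<e> \<preceq> r *\<^sub>R \<e>} =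
          {r. 0 \<preceq> (t + r) *\<^sub>R \<e> \<and> 0 \<preceq> (r - t) *\<^sub>R \<e>}"
      proof -
        have "- r *\<^sub>R \<e> \<preceq> t *\<^sub>R \<e> \<longleftrightarrow> 0 \<preceq> (t + r) *\<^sub>R \<e>"
          and "t *\<^sub>R \<e> \<preceq> r *\<^sub>R \<e> \<longleftrightarrow> 0 \<preceq> (r - t) *\<^sub>R \<e>" for r
          using le_iff_diff[of "- r *\<^sub>R \<e>" "t *\<^sub>R \<e>"] le_iff_diff[of "t *\<^sub>R \<e>" "r *\<^sub>R \<e>"]
          by (simp_all add: scaleR_left_diff_distrib scaleR_left_distrib)
        then show ?thesis by blast
      qed
      also have "\<dots> = (if \<e> \<preceq> 0 then {..- t} else {})"
        using t by (auto simp: pos_iff)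
      also have "Inf \<dots> = k"
      proof (cases "\<e> \<preceq> 0")
        case True
        have unbounded: "(\<forall>x\<in>{t..}. x \<le> z) = False" for z
          by (auto simp: not_le intro!: bexI[of _ "max t z + 1"])
        show ?thesis
          using True by (simp add: Inf_real_def Sup_real_def k_def unbounded)
      qed (simp add: k_def)
      finally show ?thesis by (simp add: ou_norm_def)
    qed
    obtain K where K: "\<forall>a\<in>car. \<bar>\<mu> a\<bar> \<le> K * ou_norm A a"
      using \<mu> by (auto simp: states_def ou_dual_def)
    define t where "t = \<bar>K * k\<bar> + 1"
    have t: "0 < t" by (simp add: t_def)
    then have "t \<le> K * k"
      using K[rule_format, of "t *\<^sub>R \<e>"] norm[OF t] state_simps[OF \<mu>] by simp
    then show False by (simp add: t_def)
  qed
qed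

end

locale positive_order_unit = order_unit +
  assumes unit_pos: "0 \<preceq> \<e>" and unit_nonzero: "\<e> \<noteq> 0"
begin

lemma unit_scale_mono: "r \<le> s \<Longrightarrow> r *\<^sub>R \<e> \<preceq> s *\<^sub>R \<e>"
  using le_scale[of 0 \<e> "s - r"] unit_pos le_iff_diff[of "r *\<^sub>R \<e>" "s *\<^sub>R \<e>"]
  by (simp add: scaleR_left_diff_distrib)

lemma unit_scale_le_iff: "r *\<^sub>R \<e> \<preceq> s *\<^sub>R \<e> \<longleftrightarrow> r \<le> s"
proof
  assume *: "r *\<^sub>R \<e> \<preceq> s *\<^sub>R \<e>"
  show "r \<le> s"
  proof (rule ccontr)
    assume "\<not> r \<le> s"
    with unit_scale_mono[of s r] * have "r *\<^sub>R \<e> = s *\<^sub>R \<e>" by (intro le_antisym) auto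
    with unit_nonzero \<open>\<not> r \<le> s\<close> show False by simp
  qed
qed (rule unit_scale_mono)

lemma le_unit_mono: "a \<in> car \<Longrightarrow> a \<preceq> r *\<^sub>R \<e> \<Longrightarrow> r \<le> s \<Longrightarrow> a \<preceq> s *\<^sub>R \<e>"
  using le_trans[of a "r *\<^sub>R \<e>" "s *\<^sub>R \<e>"] unit_scale_mono by simp

lemma minus_unit_le_iff:
  assumes "a \<in> car" shows "- r *\<^sub>R \<e> \<preceq> a \<longleftrightarrow> - a \<preceq> r *\<^sub>R \<e>"
  using le_iff_diff[of "- r *\<^sub>R \<e>" a] le_iff_diff[of "- a" "r *\<^sub>R \<e>"] assms
  by (simp add: add.commute)

lemma norm_set_bounds:
  assumes a: "a \<in> car"
  shows "{r. - r *\<^sub>R \<e> \<preceq> a \<and> a \<preceq> r *\<^sub>R \<e>} \<noteq> {}"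
    and "- r *\<^sub>R \<e> \<preceq> a \<Longrightarrow> a \<preceq> r *\<^sub>R \<e> \<Longrightarrow> 0 \<le> r"
proof -
  obtain r' s' where "a \<preceq> r' *\<^sub>R \<e>" "- a \<preceq> s' *\<^sub>R \<e>"
    using unit_bound[of a] unit_bound[of "- a"] a by auto
  then have "a \<preceq> max r' s' *\<^sub>R \<e>" "- a \<preceq> max r' s' *\<^sub>R \<e>"
    using a by (auto intro: le_unit_mono)
  then show "{r. - r *\<^sub>R \<e> \<preceq> a \<and> a \<preceq> r *\<^sub>R \<e>} \<noteq> {}"
    using minus_unit_le_iff[OF a] by auto
  show "0 \<le> r" if "- r *\<^sub>R \<e> \<preceq> a" "a \<preceq> r *\<^sub>R \<e>"
    using le_trans[of "- r *\<^sub>R \<e>" a "r *\<^sub>R \<e>"] that a unit_scale_le_iff[of "- r" r] by simp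
qed

lemma norm_le: "a \<in> car \<Longrightarrow> - r *\<^sub>R \<e> \<preceq> a \<Longrightarrow> a \<preceq> r *\<^sub>R \<e> \<Longrightarrow> ou_norm A a \<le> r"
  unfolding ou_norm_def using norm_set_bounds(2)
  by (intro cInf_lower bdd_belowI[of _ 0]) auto

lemma norm_nonneg: "a \<in> car \<Longrightarrow> 0 \<le> ou_norm A a"
  unfolding ou_norm_def using norm_set_bounds by (intro cInf_greatest) auto

lemma norm_greatest:
  assumes "a \<in> car" "\<And>r. - r *\<^sub>R \<e> \<preceq> a \<Longrightarrow> a \<preceq> r *\<^sub>R \<e> \<Longrightarrow> k \<le> r"
  shows "k \<le> ou_norm A a"
  unfolding ou_norm_def using norm_set_bounds(1) assms by (intro cInf_greatest) auto

lemma abs_state_le: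
  assumes \<mu>: "\<mu> \<in> states A" and a: "a \<in> car" and r: "- r *\<^sub>R \<e> \<preceq> a" "a \<preceq> r *\<^sub>R \<e>" "0 < r"
  shows "\<bar>\<mu> a\<bar> \<le> r"
proof -
  define b where "b = inverse r *\<^sub>R a"
  have b: "b \<in> car" using a by (simp add: b_def)
  have ab: "a = r *\<^sub>R b" using r(3) by (simp add: b_def)
  have "- 1 *\<^sub>R \<e> \<preceq> b" "b \<preceq> 1 *\<^sub>R \<e>"
    using r ab le_scale_iff[of "- \<e>" b r] le_scale_iff[of b \<e> r] b by auto
  then have "ou_norm A b \<le> 1" by (intro norm_le b) auto
  obtain K where K: "\<forall>a\<in>car. \<bar>\<mu> a\<bar> \<le> K * ou_norm A a"
    using \<mu> by (auto simp: states_def ou_dual_def)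
  have "\<bar>\<mu> c\<bar> \<le> \<bar>K\<bar>" if "c \<in> car" "ou_norm A c \<le> 1" for c
  proof -
    have "K * ou_norm A c \<le> \<bar>K\<bar> * 1"
      using that norm_nonneg[of c] by (intro mult_mono) auto
    with K[rule_format, OF that(1)] show ?thesis by simp
  qed
  then have "\<bar>\<mu> b\<bar> \<le> dual_norm A \<mu>"
    unfolding dual_norm_def using b \<open>ou_norm A b \<le> 1\<close>
    by (intro cSUP_upper bdd_aboveI[of _ "\<bar>K\<bar>"]) auto
  then have "\<bar>\<mu> b\<bar> \<le> 1" using \<mu> by (simp add: states_def)
  moreover have "\<mu> a = r * \<mu> b"
    using state_simps(2)[OF \<mu> b, of r] by (simp add: ab)
  ultimately show ?thesis
    using r(3) mult_left_mono[of "\<bar>\<mu> b\<bar>" 1 r] by (simp add: abs_mult)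
qed

text \<open>
  If \<open>0 \<preceq> a \<preceq> r \<e>\<close>, then \<open>a\<close> lies in the ball of radius \<open>r / 2\<close> about \<open>(r / 2) \<e>\<close>, and the image of
  this ball under a functional of norm one that maps \<open>\<e>\<close> to \<open>1\<close> is contained in \<open>[0, r]\<close>.
\<close>

lemma state_nonneg:
  assumes \<mu>: "\<mu> \<in> states A" and a: "a \<in> car" "0 \<preceq> a"
  shows "0 \<le> \<mu> a"
proof -
  obtain r0 where "a \<preceq> r0 *\<^sub>R \<e>" using unit_bound a by blast
  define r where "r = max 1 r0"
  have r: "0 < r" "a \<preceq> r *\<^sub>R \<e>"
    using le_unit_mono[OF a(1) \<open>a \<preceq> r0 *\<^sub>R \<e>\<close>, of r] by (auto simp: r_def)
  let ?b = "a - (r / 2) *\<^sub>R \<e>"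
  have "- (r / 2) *\<^sub>R \<e> \<preceq> ?b"
    using le_iff_diff[of "- (r / 2) *\<^sub>R \<e>" ?b] a by simp
  moreover have "?b \<preceq> (r / 2) *\<^sub>R \<e>"
    using le_iff_diff[of ?b "(r / 2) *\<^sub>R \<e>"] le_iff_diff[of a "r *\<^sub>R \<e>"] a r
    by (simp add: algebra_simps flip: scaleR_left_distrib)
  ultimately have "\<bar>\<mu> ?b\<bar> \<le> r / 2"
    using a r by (intro abs_state_le[OF \<mu>]) auto
  moreover have "\<mu> ?b = \<mu> a - r / 2"
    using a state_simps[OF \<mu>] by simp
  ultimately show ?thesis by linarith
qed

lemma state_mono:
  assumes \<mu>: "\<mu> \<in> states A" and ab: "a \<in> car" "b \<in> car" "a \<preceq> b"
  shows "\<mu> a \<le> \<mu> b"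
  using state_nonneg[OF \<mu>, of "b - a"] ab le_iff_diff[of a b] state_simps(3)[OF \<mu>, of b a] by simp

lemma statesI:
  assumes ext: "\<mu> \<in> extensional car"
    and add: "\<And>a b. a \<in> car \<Longrightarrow> b \<in> car \<Longrightarrow> \<mu> (a + b) = \<mu> a + \<mu> b"
    and scale: "\<And>r a. a \<in> car \<Longrightarrow> \<mu> (r *\<^sub>R a) = r * \<mu> a"
    and one: "\<mu> \<e> = 1"
    and pos: "\<And>a. a \<in> car \<Longrightarrow> 0 \<preceq> a \<Longrightarrow> 0 \<le> \<mu> a"
  shows "\<mu> \<in> states A"
proof -
  have bound: "\<bar>\<mu> a\<bar> \<le> ou_norm A a" if a: "a \<in> car" for a
  proof (rule norm_greatest[OF a])
    fix r assume r: "- r *\<^sub>R \<e> \<preceq> a" "a \<preceq> r *\<^sub>R \<e>"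
    have "0 \<le> \<mu> (a + r *\<^sub>R \<e>)"
      using r le_iff_diff[of "- r *\<^sub>R \<e>" a] a by (intro pos) auto
    moreover have "0 \<le> \<mu> (r *\<^sub>R \<e> + (- 1) *\<^sub>R a)"
      using r le_iff_diff[of a "r *\<^sub>R \<e>"] a by (intro pos) auto
    ultimately show "\<bar>\<mu> a\<bar> \<le> r"
      using a add[of a "r *\<^sub>R \<e>"] add[of "r *\<^sub>R \<e>" "(- 1) *\<^sub>R a"] scale[of a "- 1"]
        scale[of \<e> r] one by simp
  qed
  have "ou_norm A \<e> \<le> 1"
    using unit_scale_le_iff[of "- 1" 1] by (intro norm_le) (auto simp: le_refl)
  moreover have "\<bar>\<mu> a\<bar> \<le> 1" if "a \<in> car" "ou_norm A a \<le> 1" for a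
    using bound[OF that(1)] that(2) by simp
  ultimately have "dual_norm A \<mu> = 1"
    unfolding dual_norm_def using one
    by (intro cSup_eq_maximum) (auto intro!: image_eqI[of _ _ \<e>])
  moreover have "\<mu> \<in> ou_dual A"
    using ext add scale bound unfolding ou_dual_def by (auto intro!: exI[of _ 1])
  ultimately show ?thesis using one by (simp add: states_def)
qed

text \<open>
  The smallest \<open>r\<close> with \<open>a \<preceq> r \<e>\<close> is a sublinear function of \<open>a\<close>, and it is positive at an element
  that is not \<open>\<preceq> 0\<close>; a linear functional below it is a state after restriction to the carrier.
\<close>

lemma le_if_states:
  assumes ab: "a \<in> car" "b \<in> car" and le: "\<And>\<mu>. \<mu> \<in> states A \<Longrightarrow> \<mu> a \<le> \<mu> b"
  shows "a \<preceq> b"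
proof (rule ccontr)
  assume neg: "\<not> a \<preceq> b"
  define p where "p c = Inf {r. c \<preceq> r *\<^sub>R \<e>}" for c
  have bdd: "bdd_below {r. c \<preceq> r *\<^sub>R \<e>}" and ne: "{r. c \<preceq> r *\<^sub>R \<e>} \<noteq> {}" if c: "c \<in> car" for c
  proof -
    obtain s where "- c \<preceq> s *\<^sub>R \<e>" using unit_bound[of "- c"] c by auto
    then have s: "- s *\<^sub>R \<e> \<preceq> c" using minus_unit_le_iff c by blast
    have "- s \<le> r" if "c \<preceq> r *\<^sub>R \<e>" for r
      using le_trans[OF _ _ _ s that] c unit_scale_le_iff[of "- s" r] by simp
    then show "bdd_below {r. c \<preceq> r *\<^sub>R \<e>}" by (auto intro!: bdd_belowI[of _ "- s"])
    show "{r. c \<preceq> r *\<^sub>R \<e>} \<noteq> {}" using unit_bound c by blast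
  qed
  have p_le: "p c \<le> r" if "c \<in> car" "c \<preceq> r *\<^sub>R \<e>" for c r
    unfolding p_def using bdd that by (intro cInf_lower) auto
  have p_ge: "k \<le> p c" if "c \<in> car" "\<And>r. c \<preceq> r *\<^sub>R \<e> \<Longrightarrow> k \<le> r" for c k
    unfolding p_def using ne that by (intro cInf_greatest) auto
  define d where "d = a - b"
  have d: "d \<in> car" using ab by (simp add: d_def)
  have "\<not> d \<preceq> 0" using neg ab le_iff_diff[of a b] le_iff_diff[of d 0] d by (simp add: d_def)
  then obtain k where k: "0 < k" "\<not> d \<preceq> k *\<^sub>R \<e>" using archimedean[OF d] by blast
  have "k \<le> p d"
  proof (rule p_ge[OF d])
    fix r assume "d \<preceq> r *\<^sub>R \<e>"
    with k(2) le_unit_mono[OF d, of r k] show "k \<le> r" by linarith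
  qed
  with k(1) have p_pos: "0 < p d" by simp
  have p_add: "p (x + y) \<le> p x + p y" if xy: "x \<in> car" "y \<in> car" for x y
  proof -
    have "p (x + y) \<le> r + s" if "x \<preceq> r *\<^sub>R \<e>" "y \<preceq> s *\<^sub>R \<e>" for r s
      using le_add_mono[OF _ _ _ _ that] xy by (intro p_le) (auto simp: scaleR_left_distrib)
    then have "p (x + y) - s \<le> p x" if "y \<preceq> s *\<^sub>R \<e>" for s
      using xy that by (intro p_ge) (auto simp: algebra_simps)
    then have "p (x + y) - p x \<le> p y"
      using xy by (intro p_ge) (auto simp: algebra_simps)
    then show ?thesis by simp
  qed
  have p_scale: "p (r *\<^sub>R x) \<le> r * p x" if r: "0 < r" and x: "x \<in> car" for r x
  proof -
    have "p (r *\<^sub>R x) / r \<le> p x"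
    proof (rule p_ge[OF x])
      fix s assume "x \<preceq> s *\<^sub>R \<e>"
      then have "p (r *\<^sub>R x) \<le> r * s"
        using le_scale_iff[of x "s *\<^sub>R \<e>" r] r x by (intro p_le) auto
      with r show "p (r *\<^sub>R x) / r \<le> s" by (simp add: field_simps)
    qed
    with r show ?thesis by (simp add: field_simps)
  qed
  have p_0: "p 0 = 0"
    using p_le[of 0 0] p_ge[of 0 0] unit_scale_le_iff[of 0] by (intro antisym) (auto simp: le_refl)
  obtain f where f: "linear f" "\<And>x. x \<in> car \<Longrightarrow> f x \<le> p x" "f d = p d"
    using Hahn_Banach_subspace[OF subspace_car p_add p_scale p_0 d] by blast
  have "f \<e> \<le> 1"
    using f(2)[of \<e>] p_le[of \<e> 1] by (simp add: le_refl)
  moreover have "f (- \<e>) \<le> - 1"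
    using f(2)[of "- \<e>"] p_le[of "- \<e>" "- 1"] by (simp add: le_refl)
  ultimately have one: "f \<e> = 1" using linear_neg[OF f(1), of \<e>] by simp
  have pos: "0 \<le> f c" if c: "c \<in> car" "0 \<preceq> c" for c
  proof -
    have "f (- c) \<le> 0"
      using f(2)[of "- c"] p_le[of "- c" 0] c le_iff_diff[of "- c" 0] by simp
    then show ?thesis using linear_neg[OF f(1), of c] by simp
  qed
  have "restrict f car \<in> states A"
    using one pos by (intro statesI) (auto simp: linear_add[OF f(1)] linear_scale[OF f(1)])
  from le[OF this] have "f d \<le> 0"
    using ab by (simp add: d_def linear_diff[OF f(1)])
  with f(3) p_pos show False by simp
qed

end


section \<open>Lipschitz affine functions on a compact convex metric set\<close>

lemma scaleR_fun_apply [simp]: "(r *\<^sub>R f) x = r *\<^sub>R f x" for f :: "'a \<Rightarrow> 'b::real_vector"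
  by (simp add: scaleR_fun_def)

lemma sum_fun_apply: "sum f F x = (\<Sum>i\<in>F. f i x)" for f :: "'i \<Rightarrow> 'a \<Rightarrow> real"
  by (induction F rule: infinite_finite_induct) auto

locale compact_convex_metric =
  fixes X :: "'v::locally_convex_t2_space set" and \<rho> :: "'v \<Rightarrow> 'v \<Rightarrow> real"
  assumes nonempty: "X \<noteq> {}" and compact: "compact X" and convex: "convex X"
    and metric: "Metric_space X \<rho>"
    and compatible: "Metric_space.mtopology X \<rho> = top_of_set X"
begin

sublocale Metric_space X \<rho> by (rule metric)

abbreviation B :: "('v \<Rightarrow> real) ou_space" where "B \<equiv> Af_Lip X \<rho>"
abbreviation Lip :: "('v \<Rightarrow> real) \<Rightarrow> real" where "Lip \<equiv> Lip_seminorm X \<rho>"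

lemma B_le [simp]: "ou_le B f g \<longleftrightarrow> (\<forall>x\<in>X. f x \<le> g x)"
  and B_unit [simp]: "ou_unit B x = (if x \<in> X then 1 else 0)"
  by (simp_all add: Af_Lip_def)

lemma continuous_on_if_Lipschitz:
  fixes f :: "'v \<Rightarrow> real"
  assumes "\<And>x y. x \<in> X \<Longrightarrow> y \<in> X \<Longrightarrow> \<bar>f x - f y\<bar> \<le> K * \<rho> x y"
  shows "continuous_on X f"
proof -
  have "Lipschitz_continuous_map (metric (X, \<rho>)) euclidean_metric f"
    using assms by (auto simp: Lipschitz_continuous_map_def dist_real_def)
  then show ?thesis
    using Lipschitz_continuous_imp_continuous_map compatible by fastforce
qed

lemma mem_B_iff:
  "f \<in> ou_carrier B \<longleftrightarrow> (\<forall>x. x \<notin> X \<longrightarrow> f x = 0) \<and> affine_fun_on X f \<and>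
     (\<exists>K. \<forall>x\<in>X. \<forall>y\<in>X. \<bar>f x - f y\<bar> \<le> K * \<rho> x y)"
  unfolding Af_Lip_def Af_def affine_fun_on_def
  using continuous_on_if_Lipschitz[of f]
  by (auto simp: Lipschitz_continuous_map_def dist_real_def) blast

lemma mem_BI:
  assumes "\<And>x. x \<notin> X \<Longrightarrow> f x = 0" "affine_fun_on X f"
    "\<And>x y. x \<in> X \<Longrightarrow> y \<in> X \<Longrightarrow> \<bar>f x - f y\<bar> \<le> K * \<rho> x y"
  shows "f \<in> ou_carrier B"
  using assms by (auto simp: mem_B_iff)

lemma B_continuous: "f \<in> ou_carrier B \<Longrightarrow> continuous_on X f"
  and B_affine: "f \<in> ou_carrier B \<Longrightarrow> affine_fun_on X f"
  and B_outside: "f \<in> ou_carrier B \<Longrightarrow> x \<notin> X \<Longrightarrow> f x = 0"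
  using continuous_on_if_Lipschitz unfolding mem_B_iff by blast+

lemma Lip_le:
  assumes "0 \<le> K" "\<And>x y. x \<in> X \<Longrightarrow> y \<in> X \<Longrightarrow> \<bar>f x - f y\<bar> \<le> K * \<rho> x y"
  shows "Lip f \<le> K"
proof -
  have "\<bar>f x - f y\<bar> / \<rho> x y \<le> K" if "x \<in> X" "y \<in> X" "x \<noteq> y" for x y
  proof -
    have "0 < \<rho> x y" using that nonneg[of x y] zero[of x y] by linarith
    with assms(2)[OF that(1,2)] show ?thesis by (simp add: field_simps)
  qed
  with assms(1) show ?thesis
    unfolding Lip_seminorm_def by (intro cSup_least) auto
qed

lemma
  assumes f: "f \<in> ou_carrier B"
  shows Lip_bound: "x \<in> X \<Longrightarrow> y \<in> X \<Longrightarrow> \<bar>f x - f y\<bar> \<le> Lip f * \<rho> x y"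
    and Lip_nonneg: "0 \<le> Lip f"
proof -
  let ?S = "insert 0 {\<bar>f x - f y\<bar> / \<rho> x y |x y. x \<in> X \<and> y \<in> X \<and> x \<noteq> y}"
  obtain K where K: "\<And>x y. x \<in> X \<Longrightarrow> y \<in> X \<Longrightarrow> \<bar>f x - f y\<bar> \<le> K * \<rho> x y"
    using f unfolding mem_B_iff by blast
  have pos: "0 < \<rho> x y" if "x \<in> X" "y \<in> X" "x \<noteq> y" for x y
    using that nonneg[of x y] zero[of x y] by linarith
  have "\<bar>f x - f y\<bar> / \<rho> x y \<le> \<bar>K\<bar>" if "x \<in> X" "y \<in> X" "x \<noteq> y" for x y
  proof -
    have "K * \<rho> x y \<le> \<bar>K\<bar> * \<rho> x y" by (intro mult_right_mono) auto
    with K[OF that(1,2)] have "\<bar>f x - f y\<bar> \<le> \<bar>K\<bar> * \<rho> x y" by linarith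
    with pos[OF that] show ?thesis by (simp add: field_simps)
  qed
  then have bdd: "bdd_above ?S" by (auto intro!: bdd_aboveI[of _ "\<bar>K\<bar>"])
  show "0 \<le> Lip f" unfolding Lip_seminorm_def using bdd by (intro cSup_upper) auto
  show "\<bar>f x - f y\<bar> \<le> Lip f * \<rho> x y" if xy: "x \<in> X" "y \<in> X"
  proof (cases "x = y")
    case True
    with xy show ?thesis using zero[of x y] by simp
  next
    case False
    then have "\<bar>f x - f y\<bar> / \<rho> x y \<le> Lip f"
      unfolding Lip_seminorm_def using bdd xy by (intro cSup_upper) auto
    with pos[OF xy False] show ?thesis by (simp add: field_simps)
  qed
qed

lemma subspace_B: "subspace (ou_carrier B)"
proof (rule subspaceI)
  show "0 \<in> ou_carrier B"
    by (rule mem_BI[where K = 0]) (auto simp: zero_fun_def)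
  show "f + g \<in> ou_carrier B" if fg: "f \<in> ou_carrier B" "g \<in> ou_carrier B" for f g
  proof (rule mem_BI)
    show "\<bar>(f + g) x - (f + g) y\<bar> \<le> (Lip f + Lip g) * \<rho> x y" if "x \<in> X" "y \<in> X" for x y
      using Lip_bound[OF fg(1) that] Lip_bound[OF fg(2) that] by (simp add: distrib_right)
    show "affine_fun_on X (f + g)"
      unfolding plus_fun_def using fg by (intro affine_fun_on_add B_affine)
  qed (use fg in \<open>auto simp: B_outside\<close>)
  show "r *\<^sub>R f \<in> ou_carrier B" if f: "f \<in> ou_carrier B" for r f
  proof (rule mem_BI)
    show "\<bar>(r *\<^sub>R f) x - (r *\<^sub>R f) y\<bar> \<le> (\<bar>r\<bar> * Lip f) * \<rho> x y" if "x \<in> X" "y \<in> X" for x y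
      using mult_left_mono[OF Lip_bound[OF f that], of "\<bar>r\<bar>"]
      by (simp add: mult.assoc flip: abs_mult right_diff_distrib)
    show "affine_fun_on X (r *\<^sub>R f)"
      using affine_fun_on_scale[OF B_affine[OF f], of r] by (simp add: scaleR_fun_def)
  qed (use f in \<open>auto simp: B_outside\<close>)
qed

lemma order_unit_space_B: "order_unit_space B"
proof -
  have "partial_order_on (ou_carrier B) {(f, g) \<in> ou_carrier B \<times> ou_carrier B. ou_le B f g}"
  proof -
    have "f = g" if "f \<in> ou_carrier B" "g \<in> ou_carrier B"
        "\<forall>x\<in>X. f x \<le> g x" "\<forall>x\<in>X. g x \<le> f x" for f g
    proof
      fix x show "f x = g x"
        using that by (cases "x \<in> X") (auto simp: B_outside intro: antisym)
    qed
    then show ?thesis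
      by (auto simp: partial_order_on_def preorder_on_def refl_on_def antisym_def trans_def
          intro: order_trans)
  qed
  moreover have "ou_unit B \<in> ou_carrier B"
    using convexD[OF convex]
    by (intro mem_BI[where K = 0]) (auto simp: affine_fun_on_def Af_Lip_def)
  moreover have "\<exists>r. ou_le B f (r *\<^sub>R ou_unit B)" if "f \<in> ou_carrier B" for f
    using continuous_attains_sup[OF compact nonempty B_continuous[OF that]] by auto
  moreover have "ou_le B f 0" if "\<forall>r>0. ou_le B f (r *\<^sub>R ou_unit B)" for f
  proof -
    have "f x \<le> 0" if "x \<in> X" for x
    proof (rule field_le_epsilon)
      fix r :: real assume "0 < r"
      with \<open>\<forall>r>0. ou_le B f (r *\<^sub>R ou_unit B)\<close> that show "f x \<le> 0 + r" by auto
    qed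
    then show ?thesis by simp
  qed
  ultimately show ?thesis
    using subspace_B unfolding order_unit_space_def by (auto intro: mult_left_mono)
qed

sublocale B: positive_order_unit B
proof
  show "order_unit_space B" by (rule order_unit_space_B)
  show "ou_le B 0 (ou_unit B)" by simp
  show "ou_unit B \<noteq> 0" using nonempty by (auto simp: fun_eq_iff)
qed

definition evaluation :: "'v \<Rightarrow> ('v \<Rightarrow> real) \<Rightarrow> real" where
  "evaluation x = restrict (\<lambda>f. f x) (ou_carrier B)"

lemma evaluation_apply [simp]: "f \<in> ou_carrier B \<Longrightarrow> evaluation x f = f x"
  by (simp add: evaluation_def)

lemma evaluation_state: "x \<in> X \<Longrightarrow> evaluation x \<in> states B"
  by (intro B.statesI) (auto simp: evaluation_def)

text \<open>
  If no point of \<open>X\<close> represents the state \<open>\<mu>\<close>, the theorem of the alternative applied to the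
  functions \<open>f - \<mu> f\<close> yields an element \<open>g\<close> of the space with \<open>g < \<mu> g\<close> on all of \<open>X\<close>; this
  contradicts that \<open>\<mu>\<close> is positive and maps the order unit to \<open>1\<close>.
\<close>

lemma state_is_evaluation:
  assumes \<mu>: "\<mu> \<in> states B"
  obtains x where "x \<in> X" "\<mu> = evaluation x"
proof -
  have "\<exists>x\<in>X. \<forall>f\<in>ou_carrier B. 0 \<le> f x - \<mu> f"
  proof (rule ccontr)
    assume "\<not> (\<exists>x\<in>X. \<forall>f\<in>ou_carrier B. 0 \<le> f x - \<mu> f)"
    then have none: "\<exists>f\<in>ou_carrier B. f x - \<mu> f < 0" if "x \<in> X" for x
      using that by (auto simp: not_le)
    obtain F c where F: "finite F" "F \<subseteq> ou_carrier B"
      and neg: "\<And>x. x \<in> X \<Longrightarrow> (\<Sum>f\<in>F. c f * (f x - \<mu> f)) < (0::real)"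
    proof (rule affine_alternative[OF compact convex nonempty, of "ou_carrier B" "\<lambda>f x. f x - \<mu> f"])
      show "affine_fun_on X (\<lambda>x. f x - \<mu> f)" if "f \<in> ou_carrier B" for f
        using that by (intro affine_fun_on_diff B_affine affine_fun_on_const)
      show "continuous_on X (\<lambda>x. f x - \<mu> f)" if "f \<in> ou_carrier B" for f
        by (intro continuous_on_diff B_continuous[OF that] continuous_on_const)
    qed (use none in auto)
    define g where "g = (\<Sum>f\<in>F. c f *\<^sub>R f)"
    have g: "g \<in> ou_carrier B" "\<mu> g = (\<Sum>f\<in>F. c f * \<mu> f)"
      unfolding g_def by (rule B.state_sum[OF \<mu> F])+
    have less: "g x < \<mu> g" if "x \<in> X" for x
      using neg[OF that] by (simp add: g(2)) (simp add: g_def sum_fun_apply right_diff_distrib sum_subtractf)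
    obtain x where x: "x \<in> X" "\<And>y. y \<in> X \<Longrightarrow> g y \<le> g x"
      using continuous_attains_sup[OF compact nonempty B_continuous[OF g(1)]] by blast
    then have "ou_le B g (g x *\<^sub>R ou_unit B)" by simp
    then have "\<mu> g \<le> \<mu> (g x *\<^sub>R ou_unit B)"
      using g(1) by (intro B.state_mono[OF \<mu>]) auto
    also have "\<dots> = g x" using B.state_simps(2,4)[OF \<mu>] B.unit_in by simp
    finally show False using less[OF x(1)] by simp
  qed
  then obtain x where x: "x \<in> X" "\<And>f. f \<in> ou_carrier B \<Longrightarrow> 0 \<le> f x - \<mu> f" by blast
  have "\<mu> f = f x" if f: "f \<in> ou_carrier B" for f
    using x(2)[OF f] x(2)[of "(- 1) *\<^sub>R f"] f B.state_simps(2)[OF \<mu> f, of "- 1"] by simp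
  then have "\<mu> = evaluation x"
    using B.state_simps(5)[OF \<mu>] by (intro extensionalityI[of _ "ou_carrier B"]) (auto simp: evaluation_def)
  with x(1) show thesis using that by blast
qed

lemma seminorm_Lip: "seminorm_on (ou_carrier B) Lip"
  unfolding seminorm_on_def
proof (intro conjI ballI allI)
  have scale_le: "Lip (r *\<^sub>R f) \<le> \<bar>r\<bar> * Lip f" if f: "f \<in> ou_carrier B" for f r
  proof (rule Lip_le)
    show "\<bar>(r *\<^sub>R f) x - (r *\<^sub>R f) y\<bar> \<le> (\<bar>r\<bar> * Lip f) * \<rho> x y" if "x \<in> X" "y \<in> X" for x y
      using mult_left_mono[OF Lip_bound[OF f that], of "\<bar>r\<bar>"]
      by (simp add: mult.assoc flip: abs_mult right_diff_distrib)
  qed (use Lip_nonneg[OF f] in simp)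
  fix f assume f: "f \<in> ou_carrier B"
  show "0 \<le> Lip f" by (rule Lip_nonneg[OF f])
  show "Lip (f + g) \<le> Lip f + Lip g" if g: "g \<in> ou_carrier B" for g
  proof (rule Lip_le)
    show "\<bar>(f + g) x - (f + g) y\<bar> \<le> (Lip f + Lip g) * \<rho> x y" if "x \<in> X" "y \<in> X" for x y
      using Lip_bound[OF f that] Lip_bound[OF g that] by (simp add: distrib_right)
  qed (use Lip_nonneg[OF f] Lip_nonneg[OF g] in simp)
  show "Lip (r *\<^sub>R f) = \<bar>r\<bar> * Lip f" for r
  proof (cases "r = 0")
    case True
    then show ?thesis using scale_le[OF f, of 0] Lip_nonneg[of 0] B.car_simps(1) by simp
  next
    case False
    have "Lip (inverse r *\<^sub>R r *\<^sub>R f) \<le> \<bar>inverse r\<bar> * Lip (r *\<^sub>R f)"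
      using f by (intro scale_le) simp
    then have "\<bar>r\<bar> * Lip f \<le> Lip (r *\<^sub>R f)"
      using False by (simp add: field_simps)
    with scale_le[OF f, of r] show ?thesis by simp
  qed
qed

lemma Lip_eq_0_iff:
  assumes f: "f \<in> ou_carrier B"
  shows "Lip f = 0 \<longleftrightarrow> (\<exists>r. f = r *\<^sub>R ou_unit B)"
proof
  assume 0: "Lip f = 0"
  obtain x0 where x0: "x0 \<in> X" using nonempty by blast
  have "f x = f x0" if "x \<in> X" for x
    using Lip_bound[OF f that x0] 0 by simp
  then have "f = f x0 *\<^sub>R ou_unit B"
    by (auto simp: fun_eq_iff B_outside[OF f])
  then show "\<exists>r. f = r *\<^sub>R ou_unit B" ..
next
  assume "\<exists>r. f = r *\<^sub>R ou_unit B"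
  then have "Lip f \<le> 0" by (intro Lip_le) auto
  with Lip_nonneg[OF f] show "Lip f = 0" by simp
qed

end

lemma openin_state_dist_topology:
  "openin (state_dist_topology A L) U \<longleftrightarrow> U \<subseteq> states A \<and>
     (\<forall>\<mu>\<in>U. \<exists>r>0. \<forall>\<nu>\<in>states A. state_dist A L \<mu> \<nu> < ereal r \<longrightarrow> \<nu> \<in> U)"
proof -
  have "istopology (\<lambda>U. U \<subseteq> states A \<and>
     (\<forall>\<mu>\<in>U. \<exists>r>0. \<forall>\<nu>\<in>states A. state_dist A L \<mu> \<nu> < ereal r \<longrightarrow> \<nu> \<in> U))"
    unfolding istopology_def
  proof (intro conjI allI impI, goal_cases)
    case (2 S T)
    show ?case
    proof
      fix \<mu> assume "\<mu> \<in> S \<inter> T"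
      then obtain r s where "0 < r" "\<forall>\<nu>\<in>states A. state_dist A L \<mu> \<nu> < ereal r \<longrightarrow> \<nu> \<in> S"
        "0 < s" "\<forall>\<nu>\<in>states A. state_dist A L \<mu> \<nu> < ereal s \<longrightarrow> \<nu> \<in> T"
        using 2 by blast
      moreover have "ereal (min r s) \<le> ereal r" "ereal (min r s) \<le> ereal s" by simp_all
      ultimately show "\<exists>r>0. \<forall>\<nu>\<in>states A. state_dist A L \<mu> \<nu> < ereal r \<longrightarrow> \<nu> \<in> S \<inter> T"
        by (intro exI[of _ "min r s"]) (auto dest: less_le_trans)
    qed
  next
    case (4 K)
    then show ?case by (metis UnionE UnionI)
  qed auto
  then show ?thesis
    unfolding state_dist_topology_def by simp
qed


section \<open>Convex and midpoint-balanced metrics\<close>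

locale balanced_metric = compact_convex_metric +
  assumes convex_metric: "convex_metric X \<rho>" and balanced: "midpoint_balanced X \<rho>"
begin

lemma metric_convex:
  assumes "x \<in> X" "y \<in> X" "x' \<in> X" "y' \<in> X" "0 \<le> t" "t \<le> 1"
  shows "\<rho> (t *\<^sub>R x + (1 - t) *\<^sub>R x') (t *\<^sub>R y + (1 - t) *\<^sub>R y') \<le> t * \<rho> x y + (1 - t) * \<rho> x' y'"
  using convex_metric assms unfolding convex_metric_def by auto

text \<open>The hypothesis \<open>x - y = x' - y'\<close> says that \<open>x, y'\<close> and \<open>x', y\<close> have the same midpoint.\<close>

lemma metric_translation:
  assumes "x \<in> X" "y \<in> X" "x' \<in> X" "y' \<in> X" "x - y = x' - y'"
  shows "\<rho> x y = \<rho> x' y'"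
proof -
  have "x + y' = x' + y" using assms(5) by (simp add: algebra_simps)
  then show ?thesis using balanced assms(1-4) unfolding midpoint_balanced_def by metis
qed

text \<open>
  Convexity bounds the distances from a point of a segment to its two end points from above, and
  by the triangle inequality both bounds are attained.
\<close>

lemma metric_segment:
  assumes xy: "x \<in> X" "y \<in> X" and t: "0 \<le> t" "t \<le> 1"
  shows "\<rho> (t *\<^sub>R x + (1 - t) *\<^sub>R y) y = t * \<rho> x y"
proof -
  let ?z = "t *\<^sub>R x + (1 - t) *\<^sub>R y"
  have z: "?z \<in> X" using convexD[OF convex xy] t by simp
  have "\<rho> ?z y \<le> t * \<rho> x y"
    using metric_convex[OF xy xy(2,2) t] zero[of y y] xy by (simp flip: scaleR_left_distrib)
  moreover have "\<rho> ?z x \<le> (1 - t) * \<rho> y x"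
    using metric_convex[OF xy(1,1) xy(2,1) t] zero[of x x] xy by (simp flip: scaleR_left_distrib)
  moreover have "\<rho> x y \<le> \<rho> x ?z + \<rho> ?z y"
    using triangle xy z by blast
  ultimately show ?thesis
    using commute[of x ?z] commute[of x y] by (simp add: algebra_simps)
qed

text \<open>
  Parallel segments: after shrinking the longer one by \<open>metric_segment\<close>, they are translates of each
  other, and balancedness is invariance of the metric under translation.
\<close>

lemma metric_parallel:
  assumes X: "x \<in> X" "y \<in> X" "x' \<in> X" "y' \<in> X" and st: "0 \<le> s" "0 \<le> t"
    and eq: "s *\<^sub>R (x - y) = t *\<^sub>R (x' - y')"
  shows "s * \<rho> x y = t * \<rho> x' y'"
proof -
  have main: "s * \<rho> x y = t * \<rho> x' y'"
    if X: "x \<in> X" "y \<in> X" "x' \<in> X" "y' \<in> X" and st: "0 \<le> s" "s \<le> t" "0 < t"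
      and eq: "s *\<^sub>R (x - y) = t *\<^sub>R (x' - y')" for s t x y x' y'
  proof -
    define l where "l = s / t"
    have l: "0 \<le> l" "l \<le> 1" using st by (auto simp: l_def)
    let ?z = "l *\<^sub>R x + (1 - l) *\<^sub>R y"
    have z: "?z \<in> X" using convexD[OF convex X(1,2)] l by simp
    have "t *\<^sub>R (?z - y) = s *\<^sub>R (x - y)"
      using st by (simp add: l_def algebra_simps)
    then have "?z - y = x' - y'" using eq st(3) by (metis less_irrefl scaleR_left_imp_eq)
    then have "\<rho> ?z y = \<rho> x' y'" using X z by (intro metric_translation) auto
    then show ?thesis using metric_segment[OF X(1,2) l] st by (simp add: l_def field_simps)
  qed
  consider "s = 0" "t = 0" | "s \<le> t" "0 < t" | "t \<le> s" "0 < s" using st by linarith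
  then show ?thesis
  proof cases
    case 1
    then show ?thesis by simp
  next
    case 2
    then show ?thesis using main X st eq by blast
  next
    case 3
    then show ?thesis using main[OF X(3,4,1,2), of t s] st eq by simp
  qed
qed

text \<open>
  The assignment \<open>t (x - y) \<mapsto> t \<rho> x y\<close> is well defined on the subspace spanned by \<open>X - X\<close> by
  \<open>metric_parallel\<close>, and convexity of the metric makes it subadditive.  A linear functional dominated
  by this seminorm is \<open>1\<close>-Lipschitz on \<open>X\<close>, and the Hahn--Banach theorem provides one that attains
  the bound at the given pair.
\<close>

lemma norming_function:
  assumes x0: "x0 \<in> X" and y0: "y0 \<in> X"
  obtains f where "f \<in> ou_carrier B" "Lip f \<le> 1" "f x0 - f y0 = \<rho> x0 y0"
proof -
  define W where "W = {t *\<^sub>R (x - y) |t x y. 0 \<le> t \<and> x \<in> X \<and> y \<in> X}"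
  define p where "p w = (SOME k. \<exists>t x y. 0 \<le> t \<and> x \<in> X \<and> y \<in> X \<and> w = t *\<^sub>R (x - y) \<and> k = t * \<rho> x y)"
    for w
  have p: "p (t *\<^sub>R (x - y)) = t * \<rho> x y" if t: "0 \<le> t" and xy: "x \<in> X" "y \<in> X" for t x y
    unfolding p_def
  proof (rule some_equality)
    show "\<exists>t' x' y'. 0 \<le> t' \<and> x' \<in> X \<and> y' \<in> X \<and> t *\<^sub>R (x - y) = t' *\<^sub>R (x' - y') \<and>
        t * \<rho> x y = t' * \<rho> x' y'"
      using t xy by blast
  next
    fix k assume "\<exists>t' x' y'. 0 \<le> t' \<and> x' \<in> X \<and> y' \<in> X \<and> t *\<^sub>R (x - y) = t' *\<^sub>R (x' - y') \<and>
        k = t' * \<rho> x' y'"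
    then show "k = t * \<rho> x y" using metric_parallel t xy by metis
  qed
  have add: "v + w \<in> W \<and> p (v + w) \<le> p v + p w" if vw: "v \<in> W" "w \<in> W" for v w
  proof -
    obtain s x y where v: "v = s *\<^sub>R (x - y)" "0 \<le> s" "x \<in> X" "y \<in> X" using vw by (auto simp: W_def)
    obtain t x' y' where w: "w = t *\<^sub>R (x' - y')" "0 \<le> t" "x' \<in> X" "y' \<in> X"
      using vw by (auto simp: W_def)
    show ?thesis
    proof (cases "s + t = 0")
      case True
      then have "s = 0" "t = 0" using v w by auto
      with vw v w show ?thesis using p[of 0 x y] by auto
    next
      case False
      define l where "l = s / (s + t)"
      have st: "0 < s + t" using False v w by simp
      then have l: "0 \<le> l" "l \<le> 1" using v w by (auto simp: l_def)
      let ?a = "l *\<^sub>R x + (1 - l) *\<^sub>R x'" and ?b = "l *\<^sub>R y + (1 - l) *\<^sub>R y'"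
      have ab: "?a \<in> X" "?b \<in> X" using convexD[OF convex] v w l by auto
      have ls: "(s + t) * l = s" "(s + t) * (1 - l) = t"
        using st by (auto simp: l_def field_simps)
      have "(s + t) *\<^sub>R (?a - ?b) = ((s + t) * l) *\<^sub>R (x - y) + ((s + t) * (1 - l)) *\<^sub>R (x' - y')"
        by (simp add: scaleR_diff_right scaleR_add_right)
      then have vw_eq: "v + w = (s + t) *\<^sub>R (?a - ?b)" unfolding ls by (simp add: v w)
      have "p (v + w) = (s + t) * \<rho> ?a ?b"
        unfolding vw_eq using st ab by (intro p) auto
      also have "\<dots> \<le> (s + t) * (l * \<rho> x y + (1 - l) * \<rho> x' y')"
        using st v w l by (intro mult_left_mono metric_convex) auto
      also have "\<dots> = ((s + t) * l) * \<rho> x y + ((s + t) * (1 - l)) * \<rho> x' y'"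
        by (simp add: distrib_left)
      also have "\<dots> = p v + p w" unfolding ls by (simp add: v w p)
      finally have "p (v + w) \<le> p v + p w" .
      moreover have "0 \<le> s + t" using st by simp
      then have "v + w \<in> W" unfolding vw_eq W_def using ab by blast
      ultimately show ?thesis by simp
    qed
  qed
  have scale: "r *\<^sub>R w \<in> W" "0 < r \<Longrightarrow> p (r *\<^sub>R w) \<le> r * p w" if w: "w \<in> W" for r w
  proof -
    obtain t x y where *: "w = t *\<^sub>R (x - y)" "0 \<le> t" "x \<in> X" "y \<in> X" using w by (auto simp: W_def)
    show "p (r *\<^sub>R w) \<le> r * p w" if "0 < r"
      using p[of "r * t" x y] p[of t x y] * that by simp
    show "r *\<^sub>R w \<in> W"
    proof (cases "0 \<le> r")
      case True
      then have "r *\<^sub>R w = (r * t) *\<^sub>R (x - y)" "0 \<le> r * t" using * by auto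
      with * show ?thesis unfolding W_def by blast
    next
      case False
      then have "0 \<le> - r * t" using *(2) by (simp add: mult_nonpos_nonneg)
      moreover have "r *\<^sub>R w = (- r * t) *\<^sub>R (y - x)"
        unfolding *(1) by (simp add: algebra_simps)
      ultimately show ?thesis unfolding W_def using *(3,4) by blast
    qed
  qed
  have diff: "x - y \<in> W" "p (x - y) = \<rho> x y" if "x \<in> X" "y \<in> X" for x y
  proof -
    have "x - y = 1 *\<^sub>R (x - y)" by simp
    then show "x - y \<in> W" unfolding W_def using that zero_le_one by blast
    show "p (x - y) = \<rho> x y" using p[of 1 x y] that by simp
  qed
  have zero_W: "0 \<in> W" "p 0 = 0"
    using diff[OF x0 x0] zero[OF x0 x0] by auto
  have "subspace W"
    using zero_W add scale by (intro subspaceI) auto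
  then obtain h where h: "linear h" "\<And>w. w \<in> W \<Longrightarrow> h w \<le> p w" "h (x0 - y0) = p (x0 - y0)"
    using Hahn_Banach_subspace[of W p "x0 - y0"] add scale(2) zero_W diff(1)[OF x0 y0] by blast
  define f where "f x = (if x \<in> X then h x else 0)" for x
  have lip: "\<bar>f x - f y\<bar> \<le> 1 * \<rho> x y" if "x \<in> X" "y \<in> X" for x y
    using h(2)[of "x - y"] h(2)[of "y - x"] diff that commute[of x y]
    by (simp add: f_def linear_diff[OF h(1)])
  have "affine_fun_on X f"
    using convexD[OF convex]
    by (auto simp: affine_fun_on_def f_def linear_add[OF h(1)] linear_scale[OF h(1)])
  then have "f \<in> ou_carrier B"
    using lip by (intro mem_BI[where K = 1]) (auto simp: f_def)
  moreover have "Lip f \<le> 1" using lip by (intro Lip_le) auto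
  moreover have "f x0 - f y0 = \<rho> x0 y0"
    using h(3) diff[OF x0 y0] x0 y0 by (simp add: f_def linear_diff[OF h(1)])
  ultimately show thesis using that by blast
qed

lemma state_dist_evaluation:
  assumes xy: "x \<in> X" "y \<in> X"
  shows "state_dist B Lip (evaluation x) (evaluation y) = ereal (\<rho> x y)"
  unfolding state_dist_def
proof (rule SUP_eqI)
  fix f assume "f \<in> {f \<in> ou_carrier B. Lip f \<le> 1}"
  then have f: "f \<in> ou_carrier B" "Lip f \<le> 1" by auto
  have "Lip f * \<rho> x y \<le> 1 * \<rho> x y" using f(2) by (intro mult_right_mono) auto
  with Lip_bound[OF f(1) xy] f(1)
  show "ereal \<bar>evaluation x f - evaluation y f\<bar> \<le> ereal (\<rho> x y)" by simp
next
  fix k assume k: "\<And>f. f \<in> {f \<in> ou_carrier B. Lip f \<le> 1} \<Longrightarrow>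
    ereal \<bar>evaluation x f - evaluation y f\<bar> \<le> k"
  obtain f where f: "f \<in> ou_carrier B" "Lip f \<le> 1" "f x - f y = \<rho> x y"
    using norming_function[OF xy] by blast
  with k[of f] show "ereal (\<rho> x y) \<le> k" by simp
qed

lemma bij_evaluation: "bij_betw evaluation X (states B)"
proof (rule bij_betw_imageI)
  show "inj_on evaluation X"
  proof (rule inj_onI)
    fix x y assume xy: "x \<in> X" "y \<in> X" and eq: "evaluation x = evaluation y"
    obtain f where f: "f \<in> ou_carrier B" "f x - f y = \<rho> x y"
      using norming_function[OF xy] by blast
    have "f x = f y" using fun_cong[OF eq, of f] f(1) by simp
    with f(2) xy show "x = y" using zero by simp
  qed
  show "evaluation ` X = states B"
    using evaluation_state state_is_evaluation by blast
qed

text \<open>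
  Evaluation is a continuous bijection from a compact space onto a Hausdorff space, so the
  weak-* topology is the transport of the topology of \<open>X\<close>, which is that of \<open>\<rho>\<close>.
\<close>

lemma homeomorphic_evaluation: "homeomorphic_map (top_of_set X) (weak_star B) evaluation"
proof (rule continuous_imp_homeomorphic_map)
  have sub: "states B \<subseteq> topspace (powertop_real (ou_carrier B))"
    by (auto simp: PiE_def B.state_simps(5))
  have top: "topspace (weak_star B) = states B"
    using sub by (auto simp: weak_star_def)
  show "continuous_map (top_of_set X) (weak_star B) evaluation"
    unfolding weak_star_def continuous_map_in_subtopology continuous_map_componentwise
    using evaluation_state B_continuous by (auto simp: evaluation_def)
  show "compact_space (top_of_set X)"
    using compact by (simp add: compact_space_subtopology)
  show "Hausdorff_space (weak_star B)"
    unfolding weak_star_def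
    by (intro Hausdorff_space_subtopology) (simp add: Hausdorff_space_product_topology)
  show "evaluation ` topspace (top_of_set X) = topspace (weak_star B)"
    "inj_on evaluation (topspace (top_of_set X))"
    using bij_evaluation by (auto simp: top bij_betw_def)
qed

lemma lip_norm_Lip: "lip_norm B Lip"
proof -
  have "openin (state_dist_topology B Lip) U \<longleftrightarrow> openin (weak_star B) U" for U
  proof (cases "U \<subseteq> states B")
    case False
    moreover have "topspace (weak_star B) \<subseteq> states B" by (simp add: weak_star_def)
    ultimately show ?thesis
      using openin_subset[of "weak_star B" U] by (auto simp: openin_state_dist_topology)
  next
    case True
    define V where "V = {x \<in> X. evaluation x \<in> U}"
    have V: "V \<subseteq> X" "evaluation ` V = U"
      using True bij_evaluation by (auto simp: V_def bij_betw_def)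
    have "openin (weak_star B) U \<longleftrightarrow> openin mtopology V"
      using homeomorphic_map_openness[OF homeomorphic_evaluation, of V] V compatible by simp
    also have "\<dots> \<longleftrightarrow> (\<forall>x\<in>V. \<exists>r>0. \<forall>y\<in>X. \<rho> x y < r \<longrightarrow> y \<in> V)"
    proof -
      have "mball x r \<subseteq> V \<longleftrightarrow> (\<forall>y\<in>X. \<rho> x y < r \<longrightarrow> y \<in> V)" if "x \<in> V" for x r
        using that V(1) by (auto simp: subset_iff)
      then have "(\<forall>x\<in>V. \<exists>r>0. mball x r \<subseteq> V) \<longleftrightarrow> (\<forall>x\<in>V. \<exists>r>0. \<forall>y\<in>X. \<rho> x y < r \<longrightarrow> y \<in> V)"
        by (simp cong: ball_cong)
      with V(1) show ?thesis unfolding openin_mtopology by blast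
    qed
    also have "\<dots> \<longleftrightarrow> (\<forall>x\<in>V. \<exists>r>0. \<forall>y\<in>X.
        state_dist B Lip (evaluation x) (evaluation y) < ereal r \<longrightarrow> evaluation y \<in> U)"
    proof -
      have "(\<rho> x y < r \<longrightarrow> y \<in> V) =
          (state_dist B Lip (evaluation x) (evaluation y) < ereal r \<longrightarrow> evaluation y \<in> U)"
        if "x \<in> V" "y \<in> X" for x y r
        using that V(1) state_dist_evaluation[of x y] by (auto simp: V_def)
      then show ?thesis by (simp cong: ball_cong)
    qed
    also have "\<dots> \<longleftrightarrow> (\<forall>\<mu>\<in>evaluation ` V. \<exists>r>0. \<forall>\<nu>\<in>evaluation ` X.
        state_dist B Lip \<mu> \<nu> < ereal r \<longrightarrow> \<nu> \<in> U)"
      by simp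
    also have "\<dots> \<longleftrightarrow> openin (state_dist_topology B Lip) U"
      using True V(2) bij_evaluation by (simp add: openin_state_dist_topology bij_betw_def)
    finally show ?thesis by simp
  qed
  then have "state_dist_topology B Lip = weak_star B" by (simp add: topology_eq)
  then show ?thesis
    using seminorm_Lip Lip_eq_0_iff by (simp add: lip_norm_def)
qed

lemma cqms_B: "cqms B Lip"
  using order_unit_space_B lip_norm_Lip by (simp add: cqms_def)

lemma affinely_isometric_B: "affinely_isometric X \<rho> B Lip"
  unfolding affinely_isometric_def
  using bij_evaluation state_dist_evaluation B_affine convex
  by (intro exI[of _ evaluation]) (auto simp: affine_fun_on_def)

end


section \<open>Representation of a compact quantum metric space by affine functions\<close>

locale state_representation = compact_convex_metric X \<rho>
  for X :: "'v::locally_convex_t2_space set" and \<rho> +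
  fixes A :: "'a::real_vector ou_space" and L :: "'a \<Rightarrow> real" and \<phi> :: "'v \<Rightarrow> 'a \<Rightarrow> real"
  assumes cqms: "cqms A L"
    and bij: "bij_betw \<phi> X (states A)"
    and \<phi>_affine: "\<And>a. a \<in> ou_carrier A \<Longrightarrow> affine_fun_on X (\<lambda>x. \<phi> x a)"
    and \<phi>_dist: "\<And>x y. x \<in> X \<Longrightarrow> y \<in> X \<Longrightarrow> state_dist A L (\<phi> x) (\<phi> y) = ereal (\<rho> x y)"
begin

lemma \<phi>_state: "x \<in> X \<Longrightarrow> \<phi> x \<in> states A"
  using bij by (auto simp: bij_betw_def)

sublocale A: positive_order_unit A
proof -
  interpret order_unit A using cqms by unfold_locales (simp add: cqms_def)
  obtain x where "x \<in> X" using nonempty by blast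
  from unit_pos_if_state[OF \<phi>_state[OF this]] show "positive_order_unit A" by unfold_locales
qed

abbreviation carA :: "'a set" where "carA \<equiv> ou_carrier A"

text \<open>
  Elements of \<open>A\<close> as functions on the state space, carried over to \<open>X\<close>; the value \<open>0\<close> outside \<open>X\<close>
  puts these functions into the space \<open>Af X\<close>.
\<close>

definition rep :: "'a \<Rightarrow> 'v \<Rightarrow> real" where
  "rep a x = (if x \<in> X then \<phi> x a else 0)"

lemma rep_simps [simp]:
  "a \<in> carA \<Longrightarrow> b \<in> carA \<Longrightarrow> rep (a + b) x = rep a x + rep b x"
  "a \<in> carA \<Longrightarrow> b \<in> carA \<Longrightarrow> rep (a - b) x = rep a x - rep b x"
  "a \<in> carA \<Longrightarrow> rep (r *\<^sub>R a) x = r * rep a x"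
  "x \<in> X \<Longrightarrow> rep (ou_unit A) x = 1"
  using A.state_simps[OF \<phi>_state] by (auto simp: rep_def)

lemma rep_minus [simp]: "a \<in> carA \<Longrightarrow> rep (- a) x = - rep a x"
  using rep_simps(3)[of a "- 1" x] by (simp only: scaleR_minus1_left)

lemma rep_sum:
  assumes "finite F" "F \<subseteq> carA"
  shows "rep (\<Sum>a\<in>F. c a *\<^sub>R a) x = (\<Sum>a\<in>F. c a * rep a x)"
  using A.state_sum(2)[OF \<phi>_state assms] by (simp add: rep_def)

lemma sum_mem_carA:
  assumes "finite F" "F \<subseteq> carA"
  shows "(\<Sum>a\<in>F. c a *\<^sub>R a) \<in> carA"
  using A.state_sum(1)[OF \<phi>_state assms] nonempty by blast

lemma le_iff_rep:
  assumes "a \<in> carA" "b \<in> carA"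
  shows "ou_le A a b \<longleftrightarrow> (\<forall>x\<in>X. rep a x \<le> rep b x)"
proof
  assume "ou_le A a b"
  then show "\<forall>x\<in>X. rep a x \<le> rep b x"
    using A.state_mono[OF \<phi>_state assms] by (simp add: rep_def)
next
  assume *: "\<forall>x\<in>X. rep a x \<le> rep b x"
  have "\<mu> a \<le> \<mu> b" if \<mu>: "\<mu> \<in> states A" for \<mu>
  proof -
    obtain x where "x \<in> X" "\<mu> = \<phi> x" using \<mu> bij by (auto simp: bij_betw_def)
    with * show ?thesis by (auto simp: rep_def)
  qed
  then show "ou_le A a b" by (rule A.le_if_states[OF assms])
qed

lemma norm_bounds_iff_rep:
  assumes a: "a \<in> carA"
  shows "ou_le A (- r *\<^sub>R ou_unit A) a \<and> ou_le A a (r *\<^sub>R ou_unit A) \<longleftrightarrow> (\<forall>x\<in>X. \<bar>rep a x\<bar> \<le> r)"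
proof -
  have "\<bar>rep a x\<bar> \<le> r \<longleftrightarrow> - r \<le> rep a x \<and> rep a x \<le> r" for x by linarith
  then show ?thesis
    using le_iff_rep[of "- r *\<^sub>R ou_unit A" a] le_iff_rep[of a "r *\<^sub>R ou_unit A"] a by auto
qed

lemma norm_le_rep: "a \<in> carA \<Longrightarrow> (\<And>x. x \<in> X \<Longrightarrow> \<bar>rep a x\<bar> \<le> r) \<Longrightarrow> ou_norm A a \<le> r"
  using A.norm_le[of a r] norm_bounds_iff_rep[of a r] by blast

lemma rep_le_norm: "a \<in> carA \<Longrightarrow> x \<in> X \<Longrightarrow> \<bar>rep a x\<bar> \<le> ou_norm A a"
  by (rule A.norm_greatest) (use norm_bounds_iff_rep in blast)+

lemma L_nonneg: "a \<in> carA \<Longrightarrow> 0 \<le> L a"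
  and L_add: "a \<in> carA \<Longrightarrow> b \<in> carA \<Longrightarrow> L (a + b) \<le> L a + L b"
  and L_scale: "a \<in> carA \<Longrightarrow> L (r *\<^sub>R a) = \<bar>r\<bar> * L a"
  and L_eq_0_iff: "a \<in> carA \<Longrightarrow> L a = 0 \<longleftrightarrow> (\<exists>r. a = r *\<^sub>R ou_unit A)"
  using cqms by (auto simp: cqms_def lip_norm_def seminorm_on_def)

lemma L_sum:
  assumes "finite F" "F \<subseteq> carA" and c: "\<And>a. 0 \<le> c a"
  shows "L (\<Sum>a\<in>F. c a *\<^sub>R a) \<le> (\<Sum>a\<in>F. c a * L a)"
  using assms(1,2)
proof induction
  case empty
  have "L 0 = 0" using L_scale[of 0 0] by simp
  then show ?case by simp
next
  case (insert a F)
  then show ?case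
    using L_add[of "c a *\<^sub>R a" "\<Sum>a\<in>F. c a *\<^sub>R a"] L_scale[of a "c a"] sum_mem_carA[of F c] c[of a]
    by simp
qed

lemma rep_Lipschitz:
  assumes a: "a \<in> carA" and xy: "x \<in> X" "y \<in> X"
  shows "\<bar>rep a x - rep a y\<bar> \<le> L a * \<rho> x y"
proof (cases "L a = 0")
  case True
  then obtain r where "a = r *\<^sub>R ou_unit A" using L_eq_0_iff a by blast
  with True xy show ?thesis by simp
next
  case False
  with L_nonneg[OF a] have pos: "0 < L a" by simp
  let ?b = "inverse (L a) *\<^sub>R a"
  have "?b \<in> {a \<in> carA. L a \<le> 1}" using a pos by (simp add: L_scale)
  then have "ereal \<bar>\<phi> x ?b - \<phi> y ?b\<bar> \<le> state_dist A L (\<phi> x) (\<phi> y)"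
    unfolding state_dist_def by (rule SUP_upper)
  then have "\<bar>rep ?b x - rep ?b y\<bar> \<le> \<rho> x y"
    using xy by (simp add: \<phi>_dist rep_def)
  then have "\<bar>inverse (L a) * (rep a x - rep a y)\<bar> \<le> \<rho> x y"
    using a by (simp add: right_diff_distrib)
  then have "inverse (L a) * \<bar>rep a x - rep a y\<bar> \<le> \<rho> x y"
    using pos by (simp only: abs_mult) simp
  with pos show ?thesis by (simp add: field_simps)
qed

lemma rep_affine:
  assumes a: "a \<in> carA" shows "affine_fun_on X (rep a)"
  using \<phi>_affine[OF a] convexD[OF convex] by (auto simp: affine_fun_on_def rep_def)

lemma rep_continuous: "a \<in> carA \<Longrightarrow> continuous_on X (rep a)"
  using continuous_on_if_Lipschitz rep_Lipschitz by blast

lemma almost_norming: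
  assumes xy: "x \<in> X" "y \<in> X" and \<delta>: "0 < \<delta>"
  obtains a where "a \<in> carA" "L a \<le> 1" "\<rho> x y - \<delta> < rep a x - rep a y"
proof -
  have "ereal (\<rho> x y - \<delta>) < state_dist A L (\<phi> x) (\<phi> y)"
    using xy \<delta> by (simp add: \<phi>_dist)
  then obtain a where a: "a \<in> carA" "L a \<le> 1" "\<rho> x y - \<delta> < \<bar>\<phi> x a - \<phi> y a\<bar>"
    unfolding state_dist_def less_SUP_iff by auto
  show thesis
  proof (cases "0 \<le> rep a x - rep a y")
    case True
    with a xy that show ?thesis by (auto simp: rep_def)
  next
    case False
    show ?thesis
    proof (rule that)
      show "- a \<in> carA" "L (- a) \<le> 1" using a L_scale[OF a(1), of "- 1"] by auto
      show "\<rho> x y - \<delta> < rep (- a) x - rep (- a) y"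
        using a xy False by (simp add: rep_def[of a])
    qed
  qed
qed

text \<open>
  By the definition of the metric, for each pair of states there is an element \<open>a\<close> with
  \<open>L a \<le> Lip f\<close> whose difference at the two states is larger than that of \<open>f\<close>, up to a small error.
  The theorem of the alternative on \<open>X \<times> X\<close> makes a convex combination of such elements serve all
  pairs at once.  The pairs \<open>(x, y)\<close> and \<open>(y, x)\<close> together bound the oscillation of its difference
  with \<open>f\<close>, and a multiple of the order unit corrects the remaining constant.
\<close>

lemma approximation:
  assumes f: "f \<in> ou_carrier B" and \<epsilon>: "0 < \<epsilon>"
  obtains a where "a \<in> carA" "L a \<le> Lip f" "\<And>x. x \<in> X \<Longrightarrow> \<bar>rep a x - f x\<bar> \<le> \<epsilon>"
proof -
  define I where "I = {a \<in> carA. L a \<le> Lip f}"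
  define u where "u a = (\<lambda>z. (f (fst z) - f (snd z)) - (rep a (fst z) - rep a (snd z)) - \<epsilon>)" for a
  have I: "a \<in> carA" "L a \<le> Lip f" if "a \<in> I" for a using that by (auto simp: I_def)
  obtain F c where F: "finite F" "F \<subseteq> I" and c: "\<And>a. 0 \<le> c a"
    and neg: "\<And>z. z \<in> X \<times> X \<Longrightarrow> (\<Sum>a\<in>F. c a * u a z) < (0::real)"
  proof (rule affine_alternative[of "X \<times> X" I u])
    show "compact (X \<times> X)" "convex (X \<times> X)" "X \<times> X \<noteq> {}"
      using compact convex nonempty by (auto intro: compact_Times convex_Times)
    show "continuous_on (X \<times> X) (u a)" if "a \<in> I" for a
      unfolding u_def
      by (intro continuous_intros continuous_on_compose2[OF B_continuous[OF f]]
          continuous_on_compose2[OF rep_continuous[OF I(1)[OF that]]]) auto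
    show "affine_fun_on (X \<times> X) (u a)" if "a \<in> I" for a
    proof -
      have "affine_fun_on (X \<times> X) (\<lambda>z. g (fst z))" "affine_fun_on (X \<times> X) (\<lambda>z. g (snd z))"
        if "affine_fun_on X g" for g :: "'v \<Rightarrow> real"
        using that by (auto simp: affine_fun_on_def)
      then show ?thesis
        unfolding u_def using B_affine[OF f] rep_affine[OF I(1)[OF that]]
        by (intro affine_fun_on_diff affine_fun_on_const)
    qed
    show "\<exists>a\<in>I. u a z < 0" if z: "z \<in> X \<times> X" for z
    proof -
      obtain x y where xy: "z = (x, y)" "x \<in> X" "y \<in> X" using z by auto
      define \<delta> where "\<delta> = \<epsilon> / (Lip f + 1)"
      have L0: "0 \<le> Lip f" using Lip_nonneg[OF f] .
      have \<delta>: "0 < \<delta>" using \<epsilon> L0 by (simp add: \<delta>_def)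
      obtain a where a: "a \<in> carA" "L a \<le> 1" "\<rho> x y - \<delta> < rep a x - rep a y"
        using almost_norming[OF xy(2,3) \<delta>] by blast
      have "Lip f * \<delta> < \<epsilon>" using \<epsilon> L0 by (simp add: \<delta>_def field_simps)
      moreover have "Lip f * (\<rho> x y - \<delta>) \<le> Lip f * (rep a x - rep a y)"
        using a(3) L0 by (intro mult_left_mono) auto
      moreover have "f x - f y \<le> Lip f * \<rho> x y" using Lip_bound[OF f xy(2,3)] by simp
      ultimately have "u (Lip f *\<^sub>R a) z < 0"
        using a(1) by (simp add: u_def xy(1) algebra_simps)
      moreover have "Lip f *\<^sub>R a \<in> I"
        using a L0 mult_left_mono[OF a(2) L0] by (simp add: I_def L_scale)
      ultimately show ?thesis by blast
    qed
  qed blast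
  obtain x0 where x0: "x0 \<in> X" using nonempty by blast
  have Fc: "F \<subseteq> carA" using F(2) I by blast
  define s where "s = (\<Sum>a\<in>F. c a)"
  have s: "0 < s"
  proof (rule ccontr)
    assume "\<not> 0 < s"
    then have "s = 0" using sum_nonneg[of F c] c by (simp add: s_def)
    then have "\<forall>a\<in>F. c a = 0" using F(1) c by (simp add: s_def sum_nonneg_eq_0_iff)
    then show False using neg[of "(x0, x0)"] x0 by simp
  qed
  define b where "b = (\<Sum>a\<in>F. (c a / s) *\<^sub>R a)"
  have b: "b \<in> carA" unfolding b_def using F(1) Fc by (rule sum_mem_carA)
  have sum1: "(\<Sum>a\<in>F. c a / s) = 1" using s by (simp add: s_def flip: sum_divide_distrib)
  have "L b \<le> (\<Sum>a\<in>F. c a / s * L a)"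
    unfolding b_def using F(1) Fc c s by (intro L_sum) auto
  also have "\<dots> \<le> (\<Sum>a\<in>F. c a / s * Lip f)"
    using F(2) I(2) c s by (intro sum_mono mult_left_mono) auto
  also have "\<dots> = (\<Sum>a\<in>F. c a / s) * Lip f" by (simp only: sum_distrib_right)
  also have "\<dots> = Lip f" by (simp add: sum1)
  finally have Lb: "L b \<le> Lip f" .
  have osc: "(f x - f y) - (rep b x - rep b y) \<le> \<epsilon>" if xy: "x \<in> X" "y \<in> X" for x y
  proof -
    have "(\<Sum>a\<in>F. c a * u a (x, y)) / s < 0" using neg[of "(x, y)"] xy s by (simp add: divide_neg_pos)
    also have "(\<Sum>a\<in>F. c a * u a (x, y)) / s =
        (\<Sum>a\<in>F. c a / s * (f x - f y - \<epsilon>) - (c a / s * rep a x - c a / s * rep a y))"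
      by (simp add: u_def sum_divide_distrib algebra_simps diff_divide_distrib add_divide_distrib)
    also have "\<dots> = (\<Sum>a\<in>F. c a / s) * (f x - f y - \<epsilon>) - (rep b x - rep b y)"
      unfolding b_def rep_sum[OF F(1) Fc] by (simp only: sum_subtractf sum_distrib_right)
    finally show ?thesis by (simp add: sum1)
  qed
  define k where "k = f x0 - rep b x0"
  define a where "a = b + k *\<^sub>R ou_unit A"
  have "L (k *\<^sub>R ou_unit A) = 0" by (subst L_eq_0_iff) auto
  then have "L a \<le> Lip f"
    using L_add[OF b, of "k *\<^sub>R ou_unit A"] Lb by (simp add: a_def)
  moreover have "a \<in> carA" using b by (simp add: a_def)
  moreover have "\<bar>rep a x - f x\<bar> \<le> \<epsilon>" if x: "x \<in> X" for x
    using osc[OF x x0] osc[OF x0 x] b x by (simp add: a_def k_def)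
  ultimately show thesis using that by blast
qed

text \<open>
  The completion consists of the nonempty ones among these classes, so its elements may be identified
  with functions on \<open>X\<close>.
\<close>

definition cls :: "('v \<Rightarrow> real) \<Rightarrow> (nat \<Rightarrow> 'a) set" where
  "cls f = {s. range s \<subseteq> carA \<and> uniform_limit X (\<lambda>n. rep (s n)) f sequentially}"

lemma clsD:
  assumes "s \<in> cls f"
  shows "s n \<in> carA" "range s \<subseteq> carA" "uniform_limit X (\<lambda>n. rep (s n)) f sequentially"
  using assms by (auto simp: cls_def)

lemma cls_tendsto: "s \<in> cls f \<Longrightarrow> x \<in> X \<Longrightarrow> (\<lambda>n. rep (s n) x) \<longlonglongrightarrow> f x"
  using clsD(3) by (rule tendsto_uniform_limitI)

lemma cls_cong:
  assumes "\<And>x. x \<in> X \<Longrightarrow> f x = g x"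
  shows "cls f = cls g"
proof -
  have "uniform_limit X (\<lambda>n. rep (s n)) f sequentially \<longleftrightarrow>
      uniform_limit X (\<lambda>n. rep (s n)) g sequentially" for s
    using assms by (intro uniform_limit_cong') auto
  then show ?thesis by (simp add: cls_def)
qed

lemma cls_limit_unique: "s \<in> cls f \<Longrightarrow> s \<in> cls g \<Longrightarrow> x \<in> X \<Longrightarrow> f x = g x"
  using LIMSEQ_unique cls_tendsto by blast

lemma const_in_cls: "a \<in> carA \<Longrightarrow> (\<lambda>_. a) \<in> cls (rep a)"
  by (auto simp: cls_def intro: uniform_limit_const)

lemma add_in_cls:
  assumes s: "s \<in> cls f" and t: "t \<in> cls g"
  shows "(\<lambda>n. s n + t n) \<in> cls (f + g)"
proof -
  have "uniform_limit X (\<lambda>n x. rep (s n) x + rep (t n) x) (\<lambda>x. f x + g x) sequentially"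
    using clsD(3)[OF s] clsD(3)[OF t] by (rule uniform_limit_add)
  also have "(\<lambda>n x. rep (s n) x + rep (t n) x) = (\<lambda>n. rep (s n + t n))"
    using clsD(1)[OF s] clsD(1)[OF t] by (simp add: fun_eq_iff)
  finally have "uniform_limit X (\<lambda>n. rep (s n + t n)) (f + g) sequentially"
    unfolding plus_fun_def .
  moreover have "range (\<lambda>n. s n + t n) \<subseteq> carA"
    using clsD(1)[OF s] clsD(1)[OF t] by auto
  ultimately show ?thesis unfolding cls_def by blast
qed

lemma scale_in_cls:
  assumes s: "s \<in> cls f"
  shows "(\<lambda>n. r *\<^sub>R s n) \<in> cls (r *\<^sub>R f)"
proof -
  have "uniform_limit X (\<lambda>n x. r *\<^sub>R rep (s n) x) (\<lambda>x. r *\<^sub>R f x) sequentially"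
    using clsD(3)[OF s] by (intro uniform_limit_intros)
  also have "(\<lambda>n x. r *\<^sub>R rep (s n) x) = (\<lambda>n. rep (r *\<^sub>R s n))"
    using clsD(1)[OF s] by (simp add: fun_eq_iff)
  finally have "uniform_limit X (\<lambda>n. rep (r *\<^sub>R s n)) (r *\<^sub>R f) sequentially"
    unfolding scaleR_fun_def .
  moreover have "range (\<lambda>n. r *\<^sub>R s n) \<subseteq> carA"
    using clsD(1)[OF s] by auto
  ultimately show ?thesis unfolding cls_def by blast
qed

lemma bounded_limit:
  assumes s: "s \<in> cls f"
  obtains M where "\<And>x. x \<in> X \<Longrightarrow> \<bar>f x\<bar> \<le> M"
proof -
  have "\<forall>\<^sub>F n in sequentially. \<forall>x\<in>X. dist (rep (s n) x) (f x) < 1"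
    using clsD(3)[OF s] by (rule uniform_limitD) simp
  then obtain n where n: "\<And>x. x \<in> X \<Longrightarrow> dist (rep (s n) x) (f x) < 1"
    by (auto simp: eventually_sequentially)
  have "\<bar>f x\<bar> \<le> ou_norm A (s n) + 1" if x: "x \<in> X" for x
    using n[OF x] rep_le_norm[OF clsD(1)[OF s, of n] x] by (simp add: dist_real_def)
  then show thesis using that by blast
qed

definition supdist :: "('v \<Rightarrow> real) \<Rightarrow> ('v \<Rightarrow> real) \<Rightarrow> real" where
  "supdist f g = (SUP x\<in>X. \<bar>f x - g x\<bar>)"

lemma supdist_le: "(\<And>x. x \<in> X \<Longrightarrow> \<bar>f x - g x\<bar> \<le> r) \<Longrightarrow> supdist f g \<le> r"
  unfolding supdist_def using nonempty by (intro cSUP_least) auto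

lemma le_supdist:
  assumes s: "s \<in> cls f" and t: "t \<in> cls g" and x: "x \<in> X"
  shows "\<bar>f x - g x\<bar> \<le> supdist f g"
proof -
  obtain M where M: "\<And>x. x \<in> X \<Longrightarrow> \<bar>f x\<bar> \<le> M" using bounded_limit[OF s] by blast
  obtain N where N: "\<And>x. x \<in> X \<Longrightarrow> \<bar>g x\<bar> \<le> N" using bounded_limit[OF t] by blast
  have "\<bar>f x - g x\<bar> \<le> M + N" if "x \<in> X" for x
    using M[OF that] N[OF that] by linarith
  then have "bdd_above ((\<lambda>x. \<bar>f x - g x\<bar>) ` X)" by (auto intro!: bdd_aboveI[of _ "M + N"])
  then show ?thesis unfolding supdist_def using x by (rule cSUP_upper[rotated])
qed

lemma norm_tendsto_supdist:
  assumes s: "s \<in> cls f" and t: "t \<in> cls g"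
  shows "(\<lambda>n. ou_norm A (s n - t n)) \<longlonglongrightarrow> supdist f g"
proof (rule tendstoI)
  fix e :: real assume e: "0 < e"
  have "\<forall>\<^sub>F n in sequentially. \<forall>x\<in>X. dist (rep (s n) x) (f x) < e / 3"
    "\<forall>\<^sub>F n in sequentially. \<forall>x\<in>X. dist (rep (t n) x) (g x) < e / 3"
    using e by (intro uniform_limitD clsD(3)[OF s] clsD(3)[OF t]; simp)+
  then show "\<forall>\<^sub>F n in sequentially. dist (ou_norm A (s n - t n)) (supdist f g) < e"
  proof eventually_elim
    case (elim n)
    have st: "s n \<in> carA" "t n \<in> carA" using clsD(1) s t by auto
    have close: "\<bar>rep (s n - t n) x - (f x - g x)\<bar> < 2 * e / 3" if "x \<in> X" for x
    proof -
      have "\<bar>rep (s n) x - f x\<bar> < e / 3" "\<bar>rep (t n) x - g x\<bar> < e / 3"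
        using elim that by (auto simp: dist_real_def)
      then show ?thesis unfolding rep_simps(2)[OF st] abs_less_iff by linarith
    qed
    have "ou_norm A (s n - t n) \<le> supdist f g + 2 * e / 3"
    proof (rule norm_le_rep)
      show "\<bar>rep (s n - t n) x\<bar> \<le> supdist f g + 2 * e / 3" if "x \<in> X" for x
        using close[OF that] le_supdist[OF s t that] by linarith
    qed (use st in simp)
    moreover have "supdist f g \<le> ou_norm A (s n - t n) + 2 * e / 3"
    proof (rule supdist_le)
      show "\<bar>f x - g x\<bar> \<le> ou_norm A (s n - t n) + 2 * e / 3" if "x \<in> X" for x
        using close[OF that] rep_le_norm[OF A.car_simps(3)[OF st] that] by linarith
    qed
    ultimately show ?case using e unfolding dist_real_def by linarith
  qed
qed

lemma Cauchy_iff_cls: "s \<in> ou_Cauchy A \<longleftrightarrow> (\<exists>f. s \<in> cls f)"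
proof
  assume "s \<in> ou_Cauchy A"
  then have s: "range s \<subseteq> carA" and cauchy: "\<And>e. 0 < e \<Longrightarrow> \<exists>N. \<forall>m\<ge>N. \<forall>n\<ge>N. ou_norm A (s m - s n) < e"
    by (auto simp: ou_Cauchy_def)
  have "uniformly_Cauchy_on X (\<lambda>n. rep (s n))"
  proof (rule uniformly_Cauchy_onI)
    fix e :: real assume "0 < e"
    then obtain N where N: "\<forall>m\<ge>N. \<forall>n\<ge>N. ou_norm A (s m - s n) < e" using cauchy by blast
    have "dist (rep (s m) x) (rep (s n) x) < e" if "x \<in> X" "m \<ge> N" "n \<ge> N" for x m n
    proof -
      have mn: "s m \<in> carA" "s n \<in> carA" using s by auto
      have "\<bar>rep (s m - s n) x\<bar> \<le> ou_norm A (s m - s n)"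
        using mn that(1) by (intro rep_le_norm) auto
      also have "\<dots> < e" using N that by blast
      finally show ?thesis using mn by (simp add: dist_real_def)
    qed
    then show "\<exists>M. \<forall>x\<in>X. \<forall>m\<ge>M. \<forall>n\<ge>M. dist (rep (s m) x) (rep (s n) x) < e" by blast
  qed
  then have "uniformly_convergent_on X (\<lambda>n. rep (s n))" by (rule Cauchy_uniformly_convergent)
  with s show "\<exists>f. s \<in> cls f" by (auto simp: cls_def uniformly_convergent_on_def)
next
  assume "\<exists>f. s \<in> cls f"
  then obtain f where s: "s \<in> cls f" ..
  then have "uniformly_Cauchy_on X (\<lambda>n. rep (s n))"
    using clsD(3) by (intro uniformly_convergent_Cauchy uniformly_convergentI)
  then have cauchy: "\<exists>N. \<forall>x\<in>X. \<forall>m\<ge>N. \<forall>n\<ge>N. dist (rep (s m) x) (rep (s n) x) < e" if "0 < e" for e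
    using that by (auto simp: uniformly_Cauchy_on_def)
  have "\<exists>N. \<forall>m\<ge>N. \<forall>n\<ge>N. ou_norm A (s m - s n) < e" if e: "0 < e" for e
  proof -
    obtain N where N: "\<forall>x\<in>X. \<forall>m\<ge>N. \<forall>n\<ge>N. dist (rep (s m) x) (rep (s n) x) < e / 2"
      using cauchy[of "e / 2"] e by auto
    have "ou_norm A (s m - s n) \<le> e / 2" if "m \<ge> N" "n \<ge> N" for m n
      using N that clsD(1)[OF s] by (intro norm_le_rep) (auto simp: dist_real_def less_imp_le)
    with e show ?thesis by (intro exI[of _ N]) force
  qed
  then show "s \<in> ou_Cauchy A" using clsD(2)[OF s] by (auto simp: ou_Cauchy_def)
qed

lemma Cauchy_class:
  assumes s: "s \<in> cls f"
  shows "ou_Cauchy_rel A `` {s} = cls f"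
proof (intro set_eqI iffI)
  fix t assume "t \<in> ou_Cauchy_rel A `` {s}"
  then have "t \<in> ou_Cauchy A" and 0: "(\<lambda>n. ou_norm A (s n - t n)) \<longlonglongrightarrow> 0"
    by (auto simp: ou_Cauchy_rel_def)
  then obtain g where t: "t \<in> cls g" using Cauchy_iff_cls by blast
  have "supdist f g = 0" using LIMSEQ_unique[OF norm_tendsto_supdist[OF s t] 0] .
  then have "g x = f x" if "x \<in> X" for x using le_supdist[OF s t that] by simp
  then show "t \<in> cls f" using t cls_cong[of g f] by simp
next
  fix t assume t: "t \<in> cls f"
  have "supdist f f = 0"
  proof (rule antisym)
    show "supdist f f \<le> 0" by (rule supdist_le) simp
    obtain x where "x \<in> X" using nonempty by blast
    then show "0 \<le> supdist f f" using le_supdist[OF s s] by force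
  qed
  then show "t \<in> ou_Cauchy_rel A `` {s}"
    using norm_tendsto_supdist[OF s t] Cauchy_iff_cls s t by (auto simp: ou_Cauchy_rel_def)
qed

lemma cls_nonempty: "s \<in> cls f \<Longrightarrow> cls f \<noteq> {}" by blast

lemma cls_in_completion:
  assumes "cls f \<noteq> {}" shows "cls f \<in> completion A"
proof -
  obtain s where s: "s \<in> cls f" using assms by blast
  then have "s \<in> ou_Cauchy A" using Cauchy_iff_cls by blast
  then show ?thesis
    unfolding completion_def Cauchy_class[OF s, symmetric] by (rule quotientI)
qed

lemma completionE:
  assumes "S \<in> completion A"
  obtains f where "S = cls f" "cls f \<noteq> {}" "\<And>x. x \<notin> X \<Longrightarrow> f x = 0"
proof -
  obtain s where s: "s \<in> ou_Cauchy A" "S = ou_Cauchy_rel A `` {s}"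
    using assms unfolding completion_def by (rule quotientE)
  then obtain f where f: "s \<in> cls f" using Cauchy_iff_cls by blast
  define g where "g x = (if x \<in> X then f x else 0)" for x
  have eq: "cls f = cls g" by (rule cls_cong) (simp add: g_def)
  have "S = cls g" using s(2) Cauchy_class[OF f] eq by simp
  moreover have "cls g \<noteq> {}" using f eq by blast
  ultimately show thesis using that[of g] by (simp add: g_def)
qed

lemma cincl_cls: "a \<in> carA \<Longrightarrow> cincl A a = cls (rep a)"
  unfolding cincl_def by (intro Cauchy_class const_in_cls)

lemma cadd_cls:
  assumes "cls f \<noteq> {}" "cls g \<noteq> {}"
  shows "cadd A (cls f) (cls g) = cls (f + g)"
  using assms unfolding cadd_def by (simp add: Cauchy_class[OF add_in_cls])

lemma cscale_cls:
  assumes "cls f \<noteq> {}"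
  shows "cscale A r (cls f) = cls (r *\<^sub>R f)"
  using assms unfolding cscale_def by (simp add: Cauchy_class[OF scale_in_cls])

lemma cdist_cls:
  assumes "cls f \<noteq> {}" "cls g \<noteq> {}"
  shows "cdist A (cls f) (cls g) = supdist f g"
  unfolding cdist_def
proof (rule the_equality)
  show "\<exists>s\<in>cls f. \<exists>t\<in>cls g. (\<lambda>n. ou_norm A (s n - t n)) \<longlonglongrightarrow> supdist f g"
    using assms norm_tendsto_supdist by blast
  show "d = supdist f g"
    if "\<exists>s\<in>cls f. \<exists>t\<in>cls g. (\<lambda>n. ou_norm A (s n - t n)) \<longlonglongrightarrow> d" for d
    using that norm_tendsto_supdist LIMSEQ_unique by blast
qed

lemma supdist_tendsto_0_iff:
  assumes a: "range a \<subseteq> carA" and f: "cls f \<noteq> {}"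
  shows "(\<lambda>n. supdist (rep (a n)) f) \<longlonglongrightarrow> 0 \<longleftrightarrow> a \<in> cls f"
proof
  obtain s where s: "s \<in> cls f" using f by blast
  have le: "\<bar>rep (a n) x - f x\<bar> \<le> supdist (rep (a n)) f" if "x \<in> X" for x n
    using a by (intro le_supdist[OF const_in_cls s that]) auto
  show "a \<in> cls f" if lim: "(\<lambda>n. supdist (rep (a n)) f) \<longlonglongrightarrow> 0"
  proof -
    have "uniform_limit X (\<lambda>n. rep (a n)) f sequentially"
    proof (rule uniform_limitI)
      fix e :: real assume "0 < e"
      with lim have "\<forall>\<^sub>F n in sequentially. supdist (rep (a n)) f < e" by (rule order_tendstoD)
      then show "\<forall>\<^sub>F n in sequentially. \<forall>x\<in>X. dist (rep (a n) x) (f x) < e"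
        by eventually_elim (use le in \<open>auto simp: dist_real_def intro: le_less_trans\<close>)
    qed
    with a show ?thesis by (simp add: cls_def)
  qed
  show "(\<lambda>n. supdist (rep (a n)) f) \<longlonglongrightarrow> 0" if as: "a \<in> cls f"
  proof (rule tendstoI)
    fix e :: real assume e: "0 < e"
    have "\<forall>\<^sub>F n in sequentially. \<forall>x\<in>X. dist (rep (a n) x) (f x) < e / 2"
      using e by (intro uniform_limitD clsD(3)[OF as]) simp
    then show "\<forall>\<^sub>F n in sequentially. dist (supdist (rep (a n)) f) 0 < e"
    proof eventually_elim
      case (elim n)
      obtain x0 where x0: "x0 \<in> X" using nonempty by blast
      have "supdist (rep (a n)) f \<le> e / 2"
        using elim by (intro supdist_le) (auto simp: dist_real_def less_imp_le)
      moreover have "0 \<le> supdist (rep (a n)) f" using le[OF x0, of n] by linarith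
      ultimately show ?case using e by (simp add: dist_real_def)
    qed
  qed
qed

text \<open>
  If \<open>f \<le> g\<close>, representing sequences \<open>s\<close> and \<open>t\<close> need not be ordered, but adding to \<open>t\<close> a null
  sequence of multiples of the order unit makes them so.
\<close>

lemma cle_cls:
  assumes "cls f \<noteq> {}" "cls g \<noteq> {}"
  shows "cle A (cls f) (cls g) \<longleftrightarrow> (\<forall>x\<in>X. f x \<le> g x)"
proof
  assume "cle A (cls f) (cls g)"
  then obtain s t where st: "s \<in> cls f" "t \<in> cls g" "\<And>n. ou_le A (s n) (t n)"
    by (auto simp: cle_def)
  show "\<forall>x\<in>X. f x \<le> g x"
  proof
    fix x assume x: "x \<in> X"
    have "rep (s n) x \<le> rep (t n) x" for n
      using le_iff_rep[of "s n" "t n"] clsD(1) st x by blast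
    then show "f x \<le> g x"
      using LIMSEQ_le[OF cls_tendsto[OF st(1) x] cls_tendsto[OF st(2) x]] by blast
  qed
next
  assume fg: "\<forall>x\<in>X. f x \<le> g x"
  obtain s t where s: "s \<in> cls f" and t: "t \<in> cls g" using assms by blast
  define k where "k n = supdist (rep (s n)) f + supdist (rep (t n)) g" for n
  have "k \<longlonglongrightarrow> 0 + 0"
    unfolding k_def using supdist_tendsto_0_iff clsD(2) s t assms by (intro tendsto_add) blast+
  then have k: "k \<longlonglongrightarrow> 0" by simp
  define t' where "t' n = t n + k n *\<^sub>R ou_unit A" for n
  have t'_car: "t' n \<in> carA" for n using clsD(1)[OF t] by (simp add: t'_def)
  have rep_t': "rep (t' n) x = rep (t n) x + k n" if "x \<in> X" for n x
    using clsD(1)[OF t] that by (simp add: t'_def)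
  have "uniform_limit X (\<lambda>n x. k n) (\<lambda>x. 0) sequentially"
    using k by (auto simp: uniform_limit_iff tendsto_iff elim: eventually_mono)
  then have "uniform_limit X (\<lambda>n x. rep (t n) x + k n) (\<lambda>x. g x + 0) sequentially"
    using clsD(3)[OF t] by (intro uniform_limit_add)
  then have "uniform_limit X (\<lambda>n. rep (t' n)) g sequentially"
    using uniform_limit_cong'[of X "\<lambda>n. rep (t' n)" "\<lambda>n x. rep (t n) x + k n" g "\<lambda>x. g x + 0"] rep_t'
    by simp
  then have "t' \<in> cls g" using t'_car by (auto simp: cls_def)
  moreover have "ou_le A (s n) (t' n)" for n
  proof -
    have "rep (s n) x \<le> rep (t' n) x" if x: "x \<in> X" for x
      using le_supdist[OF const_in_cls[OF clsD(1)[OF s, of n]] s x]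
        le_supdist[OF const_in_cls[OF clsD(1)[OF t, of n]] t x] fg x
      by (fastforce simp: rep_t'[OF x] k_def abs_le_iff)
    then show ?thesis using le_iff_rep clsD(1)[OF s] t'_car by blast
  qed
  ultimately show "cle A (cls f) (cls g)" using s by (auto simp: cle_def)
qed

lemma Lbar_cls:
  assumes f: "cls f \<noteq> {}"
  shows "Lbar A L (cls f) = Inf {liminf (\<lambda>n. ereal (L (a n))) |a. a \<in> cls f}"
proof -
  have "range a \<subseteq> carA \<and> (\<lambda>n. cdist A (cincl A (a n)) (cls f)) \<longlonglongrightarrow> 0 \<longleftrightarrow> a \<in> cls f" for a
  proof (cases "range a \<subseteq> carA")
    case True
    then have an: "a n \<in> carA" for n by auto
    have "cdist A (cincl A (a n)) (cls f) = supdist (rep (a n)) f" for n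
      using cdist_cls[OF cls_nonempty[OF const_in_cls[OF an[of n]]] f] cincl_cls[OF an[of n]] by simp
    then show ?thesis using supdist_tendsto_0_iff[OF True f] True by simp
  qed (use clsD(2) in blast)
  then show ?thesis unfolding Lbar_def by simp
qed

text \<open>
  Along a subsequence that realises the lower limit, the Lipschitz estimates of \<open>rep_Lipschitz\<close> pass
  to the limit function.
\<close>

lemma limit_in_B:
  assumes s: "s \<in> cls f" and fin: "liminf (\<lambda>n. ereal (L (s n))) < \<infinity>"
    and out: "\<And>x. x \<notin> X \<Longrightarrow> f x = 0"
  shows "f \<in> ou_carrier B" and "ereal (Lip f) \<le> liminf (\<lambda>n. ereal (L (s n)))"
proof -
  have sn: "s n \<in> carA" for n by (rule clsD(1)[OF s])
  have "0 \<le> liminf (\<lambda>n. ereal (L (s n)))"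
    using L_nonneg[OF sn] by (intro Liminf_bounded) auto
  with fin obtain r where r: "liminf (\<lambda>n. ereal (L (s n))) = ereal r" "0 \<le> r"
    by (cases "liminf (\<lambda>n. ereal (L (s n)))") auto
  obtain k :: "nat \<Rightarrow> nat" where k: "strict_mono k"
    "((\<lambda>n. ereal (L (s n))) \<circ> k) \<longlonglongrightarrow> liminf (\<lambda>n. ereal (L (s n)))"
    using liminf_subseq_lim[of "\<lambda>n. ereal (L (s n))"] by blast
  have Lk: "(\<lambda>n. L (s (k n))) \<longlonglongrightarrow> r"
    using k(2) by (simp add: r o_def)
  have lip: "\<bar>f x - f y\<bar> \<le> r * \<rho> x y" if xy: "x \<in> X" "y \<in> X" for x y
  proof (rule LIMSEQ_le)
    show "(\<lambda>n. L (s (k n)) * \<rho> x y) \<longlonglongrightarrow> r * \<rho> x y"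
      using Lk by (intro tendsto_intros)
    have "(\<lambda>n. rep (s (k n)) x) \<longlonglongrightarrow> f x" "(\<lambda>n. rep (s (k n)) y) \<longlonglongrightarrow> f y"
      using LIMSEQ_subseq_LIMSEQ[OF cls_tendsto[OF s xy(1)] k(1)]
        LIMSEQ_subseq_LIMSEQ[OF cls_tendsto[OF s xy(2)] k(1)] by (simp_all add: o_def)
    then show "(\<lambda>n. \<bar>rep (s (k n)) x - rep (s (k n)) y\<bar>) \<longlonglongrightarrow> \<bar>f x - f y\<bar>"
      by (intro tendsto_intros)
    show "\<exists>N. \<forall>n\<ge>N. \<bar>rep (s (k n)) x - rep (s (k n)) y\<bar> \<le> L (s (k n)) * \<rho> x y"
      using rep_Lipschitz[OF sn xy] by blast
  qed
  have "affine_fun_on X f"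
    unfolding affine_fun_on_def
  proof (intro ballI)
    fix x y and t :: real assume "x \<in> X" "y \<in> X" "t \<in> {0..1}"
    then have *: "x \<in> X" "y \<in> X" "0 \<le> t" "t \<le> 1" by auto
    have "t *\<^sub>R x + (1 - t) *\<^sub>R y \<in> X" using convexD[OF convex] * by auto
    then have "(\<lambda>n. rep (s n) (t *\<^sub>R x + (1 - t) *\<^sub>R y)) \<longlonglongrightarrow> f (t *\<^sub>R x + (1 - t) *\<^sub>R y)"
      by (rule cls_tendsto[OF s])
    moreover have "(\<lambda>n. t * rep (s n) x + (1 - t) * rep (s n) y) \<longlonglongrightarrow> t * f x + (1 - t) * f y"
      using cls_tendsto[OF s] * by (intro tendsto_intros) auto
    ultimately show "f (t *\<^sub>R x + (1 - t) *\<^sub>R y) = t * f x + (1 - t) * f y"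
      using affine_fun_onD[OF rep_affine[OF sn] *] by (simp add: LIMSEQ_unique)
  qed
  with out lip show "f \<in> ou_carrier B" by (intro mem_BI[where K = r])
  show "ereal (Lip f) \<le> liminf (\<lambda>n. ereal (L (s n)))"
    using Lip_le[OF r(2), of f] lip by (simp add: r(1))
qed

lemma approximating_sequence:
  assumes f: "f \<in> ou_carrier B"
  obtains s where "s \<in> cls f" "\<And>n. L (s n) \<le> Lip f"
proof -
  have "\<exists>a. a \<in> carA \<and> L a \<le> Lip f \<and> (\<forall>x\<in>X. \<bar>rep a x - f x\<bar> \<le> inverse (real (Suc n)))" for n
    using approximation[OF f, of "inverse (real (Suc n))"] by (metis inverse_positive_iff_positive of_nat_0_less_iff zero_less_Suc)
  then obtain s where s: "\<And>n. s n \<in> carA" "\<And>n. L (s n) \<le> Lip f"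
      "\<And>n x. x \<in> X \<Longrightarrow> \<bar>rep (s n) x - f x\<bar> \<le> inverse (real (Suc n))"
    by metis
  have "uniform_limit X (\<lambda>n. rep (s n)) f sequentially"
  proof (rule uniform_limitI)
    fix e :: real assume "0 < e"
    with LIMSEQ_inverse_real_of_nat have "\<forall>\<^sub>F n in sequentially. inverse (real (Suc n)) < e"
      by (rule order_tendstoD)
    then show "\<forall>\<^sub>F n in sequentially. \<forall>x\<in>X. dist (rep (s n) x) (f x) < e"
      by eventually_elim (use s(3) in \<open>auto simp: dist_real_def intro: le_less_trans\<close>)
  qed
  with s(1) have "s \<in> cls f" by (auto simp: cls_def)
  with s(2) that show thesis by blast
qed

lemma B_cls_nonempty: "f \<in> ou_carrier B \<Longrightarrow> cls f \<noteq> {}"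
  using approximating_sequence by blast

lemma Lbar_eq_Lip:
  assumes f: "f \<in> ou_carrier B"
  shows "Lbar A L (cls f) = ereal (Lip f)"
  unfolding Lbar_cls[OF B_cls_nonempty[OF f]]
proof (rule antisym)
  obtain s where s: "s \<in> cls f" "\<And>n. L (s n) \<le> Lip f" using approximating_sequence[OF f] by blast
  have "Inf {liminf (\<lambda>n. ereal (L (a n))) |a. a \<in> cls f} \<le> liminf (\<lambda>n. ereal (L (s n)))"
    using s(1) by (intro Inf_lower) auto
  also have "\<dots> \<le> liminf (\<lambda>n. ereal (Lip f))"
    using s(2) by (intro Liminf_mono) auto
  finally show "Inf {liminf (\<lambda>n. ereal (L (a n))) |a. a \<in> cls f} \<le> ereal (Lip f)"
    by (simp add: Liminf_const)
  show "ereal (Lip f) \<le> Inf {liminf (\<lambda>n. ereal (L (a n))) |a. a \<in> cls f}"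
  proof (rule Inf_greatest)
    fix l assume "l \<in> {liminf (\<lambda>n. ereal (L (a n))) |a. a \<in> cls f}"
    then obtain a where a: "l = liminf (\<lambda>n. ereal (L (a n)))" "a \<in> cls f" by blast
    show "ereal (Lip f) \<le> l"
    proof (cases "l < \<infinity>")
      case True
      then show ?thesis using limit_in_B(2)[OF a(2)] B_outside[OF f] a(1) by simp
    qed simp
  qed
qed

text \<open>
  Hence the closure of \<open>A\<close>, as a set of classes of Cauchy sequences, is a copy of the space of
  Lipschitz affine functions on \<open>X\<close>, whatever \<open>A\<close> is.
\<close>

lemma bij_cls: "bij_betw cls (ou_carrier B) (closure_carrier A L)"
proof (rule bij_betw_imageI)
  show "inj_on cls (ou_carrier B)"
  proof (rule inj_onI)
    fix f g assume f: "f \<in> ou_carrier B" and g: "g \<in> ou_carrier B" and eq: "cls f = cls g"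
    obtain s where "s \<in> cls f" using B_cls_nonempty[OF f] by blast
    then have "f x = g x" if "x \<in> X" for x using cls_limit_unique eq that by blast
    then show "f = g" using B_outside[OF f] B_outside[OF g] by (metis ext)
  qed
  show "cls ` ou_carrier B = closure_carrier A L"
  proof (intro equalityI subsetI)
    fix S assume "S \<in> cls ` ou_carrier B"
    then obtain f where f: "f \<in> ou_carrier B" "S = cls f" by blast
    then show "S \<in> closure_carrier A L"
      using Lbar_eq_Lip cls_in_completion[OF B_cls_nonempty] by (simp add: closure_carrier_def)
  next
    fix S assume "S \<in> closure_carrier A L"
    then have S: "S \<in> completion A" "Lbar A L S < \<infinity>" by (auto simp: closure_carrier_def)
    obtain f where f: "S = cls f" "cls f \<noteq> {}" "\<And>x. x \<notin> X \<Longrightarrow> f x = 0"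
      using completionE[OF S(1)] by blast
    have "Inf {liminf (\<lambda>n. ereal (L (a n))) |a. a \<in> cls f} < \<infinity>"
      using S(2) unfolding f(1) Lbar_cls[OF f(2)] .
    then obtain s where "s \<in> cls f" "liminf (\<lambda>n. ereal (L (s n))) < \<infinity>"
      unfolding Inf_less_iff by blast
    then have "f \<in> ou_carrier B" using f(3) by (rule limit_in_B(1))
    with f(1) show "S \<in> cls ` ou_carrier B" by blast
  qed
qed

lemma cincl_unit: "cincl A (ou_unit A) = cls (ou_unit B)"
  using cincl_cls[OF A.unit_in] cls_cong[of "rep (ou_unit A)" "ou_unit B"] by simp

end


section \<open>Characterisation and uniqueness\<close>

text \<open>
  Each \<open>a\<close> contributes to the metric on states a term \<open>\<bar>\<mu> a - \<nu> a\<bar>\<close>, which depends only on \<open>\<mu> - \<nu>\<close>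
  and is convex in it.  Both properties survive the supremum over \<open>a\<close>.
\<close>

lemma affinely_isometric_metric:
  fixes X :: "'v::locally_convex_t2_space set" and A :: "'a::real_vector ou_space"
  assumes "affinely_isometric X \<rho> A L" and convex: "convex X"
  shows "convex_metric X \<rho>" and "midpoint_balanced X \<rho>"
proof -
  obtain \<phi> where aff: "\<And>x y t a. x \<in> X \<Longrightarrow> y \<in> X \<Longrightarrow> t \<in> {0..1} \<Longrightarrow> a \<in> ou_carrier A \<Longrightarrow>
        \<phi> (t *\<^sub>R x + (1 - t) *\<^sub>R y) a = t * \<phi> x a + (1 - t) * \<phi> y a"
    and dist: "\<And>x y. x \<in> X \<Longrightarrow> y \<in> X \<Longrightarrow> state_dist A L (\<phi> x) (\<phi> y) = ereal (\<rho> x y)"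
    using assms(1) unfolding affinely_isometric_def by blast
  have le: "\<bar>\<phi> x a - \<phi> y a\<bar> \<le> \<rho> x y" if "x \<in> X" "y \<in> X" "a \<in> ou_carrier A" "L a \<le> 1" for x y a
  proof -
    have "ereal \<bar>\<phi> x a - \<phi> y a\<bar> \<le> state_dist A L (\<phi> x) (\<phi> y)"
      unfolding state_dist_def using that by (intro SUP_upper) auto
    with dist[OF that(1,2)] show ?thesis by simp
  qed
  show "convex_metric X \<rho>"
    unfolding convex_metric_def
  proof (intro ballI)
    fix x y x' y' and t :: real
    assume *: "x \<in> X" "y \<in> X" "x' \<in> X" "y' \<in> X" "t \<in> {0..1}"
    let ?x = "t *\<^sub>R x + (1 - t) *\<^sub>R x'" and ?y = "t *\<^sub>R y + (1 - t) *\<^sub>R y'"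
    have "?x \<in> X" "?y \<in> X" using convexD[OF convex] * by auto
    then have "ereal (\<rho> ?x ?y) = state_dist A L (\<phi> ?x) (\<phi> ?y)" by (simp add: dist)
    also have "\<dots> \<le> ereal (t * \<rho> x y + (1 - t) * \<rho> x' y')"
      unfolding state_dist_def
    proof (rule SUP_least)
      fix a assume a: "a \<in> {a \<in> ou_carrier A. L a \<le> 1}"
      have "\<phi> ?x a - \<phi> ?y a = t * (\<phi> x a - \<phi> y a) + (1 - t) * (\<phi> x' a - \<phi> y' a)"
        using aff[OF *(1,3,5)] aff[OF *(2,4,5)] a by (simp add: algebra_simps)
      then have "\<bar>\<phi> ?x a - \<phi> ?y a\<bar> \<le> \<bar>t * (\<phi> x a - \<phi> y a)\<bar> + \<bar>(1 - t) * (\<phi> x' a - \<phi> y' a)\<bar>"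
        by linarith
      also have "\<dots> = t * \<bar>\<phi> x a - \<phi> y a\<bar> + (1 - t) * \<bar>\<phi> x' a - \<phi> y' a\<bar>"
        using *(5) by (simp add: abs_mult)
      also have "\<dots> \<le> t * \<rho> x y + (1 - t) * \<rho> x' y'"
        using a * by (intro add_mono mult_left_mono le) auto
      finally show "ereal \<bar>\<phi> ?x a - \<phi> ?y a\<bar> \<le> ereal (t * \<rho> x y + (1 - t) * \<rho> x' y')" by simp
    qed
    finally show "\<rho> ?x ?y \<le> t * \<rho> x y + (1 - t) * \<rho> x' y'" by simp
  qed
  show "midpoint_balanced X \<rho>"
    unfolding midpoint_balanced_def
  proof (intro ballI impI)
    fix x y x' y'
    assume *: "x \<in> X" "y \<in> X" "x' \<in> X" "y' \<in> X"
      and eq: "(1 / 2) *\<^sub>R (x + y') = (1 / 2) *\<^sub>R (x' + y)"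
    have "\<phi> x a - \<phi> y a = \<phi> x' a - \<phi> y' a" if a: "a \<in> ou_carrier A" for a
      using aff[OF *(1,4) _ a, of "1/2"] aff[OF *(3,2) _ a, of "1/2"] eq
      by (simp add: scaleR_add_right)
    then have "state_dist A L (\<phi> x) (\<phi> y) = state_dist A L (\<phi> x') (\<phi> y')"
      unfolding state_dist_def by (intro SUP_cong) auto
    then show "\<rho> x y = \<rho> x' y'" using * by (simp add: dist)
  qed
qed

context compact_convex_metric
begin

lemma representationE:
  assumes "cqms A L" "affinely_isometric X \<rho> A L"
  obtains \<phi> where "state_representation X \<rho> A L \<phi>"
proof -
  obtain \<phi> where "bij_betw \<phi> X (states A)"
    "\<forall>x\<in>X. \<forall>y\<in>X. \<forall>t\<in>{0..1}. \<forall>a\<in>ou_carrier A.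
       \<phi> (t *\<^sub>R x + (1 - t) *\<^sub>R y) a = t * \<phi> x a + (1 - t) * \<phi> y a"
    "\<forall>x\<in>X. \<forall>y\<in>X. state_dist A L (\<phi> x) (\<phi> y) = ereal (\<rho> x y)"
    using assms(2) unfolding affinely_isometric_def by blast
  then have "state_representation X \<rho> A L \<phi>"
    using assms(1) by unfold_locales (auto simp: affine_fun_on_def)
  then show thesis by (rule that)
qed

end

text \<open>
  Both closures are copies of the space of Lipschitz affine functions on \<open>X\<close>, with the same
  operations, order and seminorm; the isometry identifies the classes of the same function.
\<close>

lemma state_representations_isometric:
  assumes "state_representation X \<rho> A L \<phi>" and "state_representation X \<rho> A' L' \<phi>'"
  shows "cqms_isometric A L A' L'"
proof -
  interpret A: state_representation X \<rho> A L \<phi> by (rule assms(1))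
  interpret A': state_representation X \<rho> A' L' \<phi>' by (rule assms(2))
  let ?B = "ou_carrier (Af_Lip X \<rho>)"
  define \<psi> where "\<psi> = A'.cls \<circ> inv_into ?B A.cls"
  have \<psi>: "\<psi> (A.cls f) = A'.cls f" if "f \<in> ?B" for f
    using that A.bij_cls by (simp add: \<psi>_def bij_betw_def)
  have closure: "closure_carrier A L = A.cls ` ?B"
    using A.bij_cls by (simp add: bij_betw_def)
  have ne: "A.cls f \<noteq> {}" "A'.cls f \<noteq> {}" if "f \<in> ?B" for f
    using A.B_cls_nonempty A'.B_cls_nonempty that by auto
  have B: "ou_unit (Af_Lip X \<rho>) \<in> ?B" "f \<in> ?B \<Longrightarrow> g \<in> ?B \<Longrightarrow> f + g \<in> ?B" "f \<in> ?B \<Longrightarrow> r *\<^sub>R f \<in> ?B"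
    for f g r by (rule A.B.unit_in A.B.car_simps; assumption)+
  have "bij_betw \<psi> (closure_carrier A L) (closure_carrier A' L')"
    unfolding \<psi>_def using bij_betw_inv_into[OF A.bij_cls] A'.bij_cls by (rule bij_betw_trans)
  then show ?thesis
    unfolding cqms_isometric_def closure ball_simps
    by (intro exI[of _ \<psi>] conjI ballI allI)
      (simp_all add: \<psi> ne B A.cadd_cls A'.cadd_cls A.cscale_cls A'.cscale_cls A.cle_cls A'.cle_cls
        A.cincl_unit A'.cincl_unit A.Lbar_eq_Lip A'.Lbar_eq_Lip)
qed

context balanced_metric
begin

lemma cqms_closed_B: "cqms_closed B Lip"
proof -
  have aff: "affine_fun_on X (\<lambda>x. evaluation x f)" if "f \<in> ou_carrier B" for f
    using B_affine[OF that] that by simp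
  interpret R: state_representation X \<rho> B Lip evaluation
    using cqms_B bij_evaluation aff state_dist_evaluation by unfold_locales
  have "cincl B f = R.cls f" if f: "f \<in> ou_carrier B" for f
    using R.cincl_cls[OF f] R.cls_cong[of "R.rep f" f] f by (simp add: R.rep_def)
  then show ?thesis
    using R.bij_cls R.Lbar_eq_Lip by (simp add: cqms_closed_def bij_betw_def)
qed

end

theorem proposition3p1:
  fixes X :: "'v::locally_convex_t2_space set" and \<rho> :: "'v \<Rightarrow> 'v \<Rightarrow> real"
  assumes "X \<noteq> {}" and "compact X" and "convex X"
    and "Metric_space X \<rho>"
    and "Metric_space.mtopology X \<rho> = top_of_set X"
  shows
    "((\<exists>(A :: ('v \<Rightarrow> real) ou_space) L. cqms A L \<and> affinely_isometric X \<rho> A L) \<longleftrightarrow>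
        convex_metric X \<rho> \<and> midpoint_balanced X \<rho>) \<and>
     (\<forall>(A :: 'a::real_vector ou_space) L. cqms A L \<and> affinely_isometric X \<rho> A L \<longrightarrow>
        convex_metric X \<rho> \<and> midpoint_balanced X \<rho>) \<and>
     (convex_metric X \<rho> \<and> midpoint_balanced X \<rho> \<longrightarrow>
        cqms (Af_Lip X \<rho>) (Lip_seminorm X \<rho>) \<and>
        cqms_closed (Af_Lip X \<rho>) (Lip_seminorm X \<rho>) \<and>
        affinely_isometric X \<rho> (Af_Lip X \<rho>) (Lip_seminorm X \<rho>) \<and>
        (\<forall>(A :: 'a::real_vector ou_space) L. cqms A L \<and> affinely_isometric X \<rho> A L \<longrightarrow>
           cqms_isometric A L (Af_Lip X \<rho>) (Lip_seminorm X \<rho>)))"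
proof -
  interpret compact_convex_metric X \<rho>
    by (rule compact_convex_metric.intro) (fact assms)+
  have main: "cqms B Lip \<and> cqms_closed B Lip \<and> affinely_isometric X \<rho> B Lip"
    if "convex_metric X \<rho> \<and> midpoint_balanced X \<rho>"
  proof -
    interpret balanced_metric X \<rho> using that by unfold_locales auto
    show ?thesis using cqms_B cqms_closed_B affinely_isometric_B by simp
  qed
  have unique: "cqms_isometric A L B Lip"
    if cb: "convex_metric X \<rho> \<and> midpoint_balanced X \<rho>"
      and A: "cqms A L" "affinely_isometric X \<rho> A L"
    for A :: "'a ou_space" and L
  proof -
    obtain \<phi> where \<phi>: "state_representation X \<rho> A L \<phi>" using representationE[OF A] .
    obtain \<psi> where \<psi>: "state_representation X \<rho> B Lip \<psi>"
      using representationE[of B Lip] main[OF cb] by blast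
    show ?thesis by (rule state_representations_isometric[OF \<phi> \<psi>])
  qed
  have necessary: "convex_metric X \<rho> \<and> midpoint_balanced X \<rho>"
    if "affinely_isometric X \<rho> A L" for A :: "'a ou_space" and L
    using affinely_isometric_metric[OF that assms(3)] by simp
  have necessary': "convex_metric X \<rho> \<and> midpoint_balanced X \<rho>"
    if "affinely_isometric X \<rho> A L" for A :: "('v \<Rightarrow> real) ou_space" and L
    using affinely_isometric_metric[OF that assms(3)] by simp
  show ?thesis
    using main unique necessary necessary' by blast
qed

end
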